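(* Let $\nu=(\nu_1,\dots,\nu_\ell)$ be an integer partition, $\mu$ a strict partition and $Q$ a symmetric function. Then there exists $r\in\mathbb{N}$ such that $$D^r\Bigl(\frac{Q\bigl(\binom{c_\square}{2}:\square\in\lambda\bigr)\,q_\nu(\lambda)}{H_\lambda}\Bigr)=0$$ for every strict partition $\lambda$. Consequently, $$P(n)=\sum_{|\lambda/\mu|=n}\frac{2^{|\lambda|-|\mu|-\ell(\lambda)+\ell(\mu)}f_{\lambda/\mu}}{H_\lambda}\,Q\Bigl(\tbinom{c_\square}{2}:\square\in\lambda\Bigr)\,q_\nu(\lambda)$$ is a polynomial in $n$, where the sum ranges over strict partitions $\lambda\supseteq\mu$ with $|\lambda|-|\mu|=n$.
   Context: A strict partition is a finite strictly decreasing sequence of positive integers $\lambda=(\lambda_1>\cdots>\lambda_\ell)$ (the empty sequence is allowed); $|\lambda|=\sum_i\lambda_i$, $\ell(\lambda)=\ell$, and $\lambda_i=0$ for $i>\ell(\lambda)$. The (shifted Young) diagram of $\lambda$ is the set of boxes $(i,j)$ with $1\le i\le\ell(\lambda)$, $i+1\le j\le i+\lambda_i$ (row $i$, column $j$); $\lambda$ is identified with its diagram. The content of $\square=(i,j)$ is $c_\square=j-i$. The hook length $h_\square$ of $\square=(i,j)\in\lambda$ is the number of boxes of $\lambda$ in row $i$ strictly to the right of $\square$, plus the number of boxes $(i',j)\in\lambda$ with $i'>i$, plus $1$, plus $\lambda_j$; $H_\lambda=\prod_{\square\in\lambda}h_\square$ ($H_\emptyset=1$). Write $\lambda\supseteq\mu$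 if $\lambda_i\ge\mu_i$ for all $i$; $\lambda/\mu$ is the set of boxes of $\lambda$ not in $\mu$, $|\lambda/\mu|=|\lambda|-|\mu|$. $f_{\lambda/\mu}$ is the number of standard shifted Young tableaux of shape $\lambda/\mu$ (bijective fillings of the boxes of $\lambda/\mu$ with $1,\dots,|\lambda/\mu|$ increasing along rows left to right and columns top to bottom; $f_{\mu/\mu}=1$). $Q(\binom{c_\square}{2}:\square\in\lambda)$ means $Q$ evaluated with $|\lambda|$ of its variables specialized to $\binom{c_\square}{2}$, $\square\in\lambda$, and all other variables to $0$. An outer corner of $\lambda$ is a box of $\lambda$ whose removal leaves the diagram of a strict partition; let $(\alpha_1,\beta_1),\dots,(\alpha_m,\beta_m)$ be the outer corners with $\alpha_1>\cdots>\alpha_m$, $y_j=\beta_j-\alpha_j$; set $\alpha_{m+1}=0$, $\beta_0=\ell(\lambda)+1$, $x_i=\beta_i-\alpha_{i+1}$ ($0\le i\le m$). $q_k(\lambda)=\sum_{i=0}^m\binom{x_i}{2}^k-\sum_{i=1}^m\binom{y_i}{2}^k$ and $q_\nu(\lambda)=\prod_{j=1}^\ell q_{\nu_j}(\lambda)$ ($q_\emptyset=1$). $\lambda^+$ ranges over strict partitions obtained from $\lambda$ by adding one box; $DG(\lambda)=\sum_{\lambda^+:\ell(\lambda^+)>\ell(\lambda)}G(\lambda^+)+2\sum_{\lambda^+:\ell(\lambda^+)=\ell(\lambda)}G(\lambda^+)-G(\lambda)$, and $D^r$ is its $r$-th iterate. *)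

theory Defs
  imports Complex_Main "HOL-Library.Multiset" "HOL-Library.Product_Lexorder"
    "HOL-Computational_Algebra.Polynomial"
begin

definition strict_part :: "nat list \<Rightarrow> bool" where
  "strict_part l \<longleftrightarrow> sorted_wrt (>) l \<and> (\<forall>x\<in>set l. 0 < x)"

definition int_partition :: "nat list \<Rightarrow> bool" where
  "int_partition l \<longleftrightarrow> sorted_wrt (\<ge>) l \<and> (\<forall>x\<in>set l. 0 < x)"

definition part_at :: "nat list \<Rightarrow> nat \<Rightarrow> nat" where
  "part_at l i = (if 1 \<le> i \<and> i \<le> length l then l ! (i - 1) else 0)"

definition diagram :: "nat list \<Rightarrow> (nat \<times> nat) set" where
  "diagram l = {(i, j). 1 \<le> i \<and> i \<le> length l \<and> i + 1 \<le> j \<and> j \<le> i + part_at l i}"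

definition hook :: "nat list \<Rightarrow> nat \<times> nat \<Rightarrow> nat" where
  "hook l b = (case b of (i, j) \<Rightarrow>
      card {j'. (i, j') \<in> diagram l \<and> j' > j} + card {i'. (i', j) \<in> diagram l \<and> i' > i}
      + 1 + part_at l j)"

definition H :: "nat list \<Rightarrow> nat" where
  "H l = (\<Prod>b\<in>diagram l. hook l b)"

definition contains :: "nat list \<Rightarrow> nat list \<Rightarrow> bool" where
  "contains l m \<longleftrightarrow> (\<forall>i. part_at m i \<le> part_at l i)"

definition skew :: "nat list \<Rightarrow> nat list \<Rightarrow> (nat \<times> nat) set" where
  "skew l m = diagram l - diagram m"

definition num_syt :: "nat list \<Rightarrow> nat list \<Rightarrow> nat" where
  "num_syt l m = card {T :: nat \<times> nat \<Rightarrow> nat.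
      bij_betw T (skew l m) {1..card (skew l m)} \<and>
      (\<forall>x. x \<notin> skew l m \<longrightarrow> T x = 0) \<and>
      (\<forall>i j j'. (i, j) \<in> skew l m \<longrightarrow> (i, j') \<in> skew l m \<longrightarrow> j < j' \<longrightarrow> T (i, j) < T (i, j')) \<and>
      (\<forall>i i' j. (i, j) \<in> skew l m \<longrightarrow> (i', j) \<in> skew l m \<longrightarrow> i < i' \<longrightarrow> T (i, j) < T (i', j))}"

definition outer_corners :: "nat list \<Rightarrow> (nat \<times> nat) set" where
  "outer_corners l = {b \<in> diagram l. \<exists>k. strict_part k \<and> diagram k = diagram l - {b}}"

text \<open>Corners listed with strictly decreasing rows (alpha_1 > ... > alpha_m); distinct corners
  lie in distinct rows, so decreasing lexicographic order is decreasing row order.\<close>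
definition corner_list :: "nat list \<Rightarrow> (nat \<times> nat) list" where
  "corner_list l = rev (sorted_list_of_set (outer_corners l))"

definition c_alpha :: "nat list \<Rightarrow> nat \<Rightarrow> int" where
  "c_alpha l i = (if 1 \<le> i \<and> i \<le> length (corner_list l) then int (fst (corner_list l ! (i - 1))) else 0)"

definition c_beta :: "nat list \<Rightarrow> nat \<Rightarrow> int" where
  "c_beta l i = (if i = 0 then int (length l) + 1 else int (snd (corner_list l ! (i - 1))))"

definition binom2 :: "int \<Rightarrow> real" where
  "binom2 x = of_int x * (of_int x - 1) / 2"

definition qk :: "nat list \<Rightarrow> nat \<Rightarrow> real" where
  "qk l k = (let m = length (corner_list l) in
     (\<Sum>i=0..m. binom2 (c_beta l i - c_alpha l (i + 1)) ^ k)
     - (\<Sum>i=1..m. binom2 (c_beta l i - c_alpha l i) ^ k))"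

definition qnu :: "nat list \<Rightarrow> nat list \<Rightarrow> real" where
  "qnu nu l = prod_list (map (qk l) nu)"

text \<open>A symmetric function Q is given by its coefficients in the monomial basis m_alpha,
  alpha ranging over integer partitions: Q = sum_alpha Q(alpha) m_alpha (finite support).
  Evaluation at variables indexed by a finite set B with values v b, all other variables 0.\<close>

definition mono_sym_eval :: "nat list \<Rightarrow> 'b set \<Rightarrow> ('b \<Rightarrow> real) \<Rightarrow> real" where
  "mono_sym_eval \<alpha> B v = (\<Sum>e\<in>{e :: 'b \<Rightarrow> nat. (\<forall>x. x \<notin> B \<longrightarrow> e x = 0) \<and>
        filter_mset (\<lambda>k. k \<noteq> 0) (image_mset e (mset_set B)) = mset \<alpha>}.
      \<Prod>b\<in>B. v b ^ e b)"

definition sym_eval :: "(nat list \<Rightarrow> real) \<Rightarrow> 'b set \<Rightarrow> ('b \<Rightarrow> real) \<Rightarrow> real" where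
  "sym_eval Q B v = (\<Sum>\<alpha>\<in>{\<alpha>. Q \<alpha> \<noteq> 0}. Q \<alpha> * mono_sym_eval \<alpha> B v)"

definition is_symfun :: "(nat list \<Rightarrow> real) \<Rightarrow> bool" where
  "is_symfun Q \<longleftrightarrow> finite {\<alpha>. Q \<alpha> \<noteq> 0} \<and> (\<forall>\<alpha>. Q \<alpha> \<noteq> 0 \<longrightarrow> int_partition \<alpha>)"

definition content_binom :: "nat \<times> nat \<Rightarrow> real" where
  "content_binom b = (case b of (i, j) \<Rightarrow> binom2 (int j - int i))"

definition plus_boxes :: "nat list \<Rightarrow> nat list set" where
  "plus_boxes l = {k. strict_part k \<and> contains k l \<and> sum_list k = sum_list l + 1}"

definition Dop :: "(nat list \<Rightarrow> real) \<Rightarrow> nat list \<Rightarrow> real" where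
  "Dop G l = (\<Sum>k\<in>{k\<in>plus_boxes l. length k > length l}. G k)
     + 2 * (\<Sum>k\<in>{k\<in>plus_boxes l. length k = length l}. G k) - G l"

end

(*  On functions of the form F / H with F in the algebra generated by the q_k and the monomial
    symmetric functions of the contents, Dop lowers degree: give q_k degree k and m_alpha degree
    |alpha| + length alpha, and let X = binom2 c for the content c of an added box. Adding the box
    changes a generator by a polynomial in X of total degree one less. The weights H l / H k
    (doubled when no new row is created) are the residues of
    (1/t) prod_b (t - binom2 b) / (t - binom2 (b + 1)), b ranging over the parts of l, at the
    points t = X. Hence the weighted sums of X^k are the complete homogeneous functions of a
    difference of alphabets whose power sums are the q_k, and Newton's identity turns X^k into
    an element of degree k. The weights sum to 1, so the leading term cancels.

    The sum P(n) is the n-th iterate of Dop + id evaluated at mu, so the binomial theorem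
    makes it a polynomial in n. *)
theory Submission
  imports Defs "HOL-Computational_Algebra.Polynomial_FPS"
begin

section \<open>Hook lengths\<close>

text \<open>The set of parts is the right carrier, not the diagram. Adding a box replaces a part
  \<open>i\<close> by \<open>i + 1\<close>, the new box has content \<open>i + 1\<close> in whatever
  row it lies, and hook product and \<open>q_k\<close> are both expressions over the set of parts.
  The corner description hides this, since only some parts can grow. The residue at every other part
  is zero, so averages may run over all parts; dually, the corner formula for \<open>q_k\<close> is
  a telescoped sum of first differences over all parts.

  The quadratic \<open>binom2\<close> fits for two reasons. The difference
  \<open>binom2 (i + 1) - binom2 b = (i + b) * (i + 1 - b) / 2\<close> splits into the sums and
  differences of parts that occur in the hook product. And the reflection \<open>c -> 1 - c\<close>
  fixes \<open>binom2 c\<close> while it exchanges \<open>binom2 (c + 1)\<close> and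
  \<open>binom2 (c - 1)\<close>, so symmetric expressions in these two neighbours, such as the
  change of \<open>q_k\<close>, are polynomials in \<open>binom2 c\<close>.\<close>

lemma strict_part_Cons [simp]:
  "strict_part (a # r) \<longleftrightarrow> 0 < a \<and> (\<forall>b\<in>set r. b < a) \<and> strict_part r"
  by (auto simp: strict_part_def)

lemma part_at_Cons_Suc [simp]: "1 \<le> i \<Longrightarrow> part_at (a # r) (Suc i) = part_at r i"
  by (auto simp: part_at_def nth_Cons split: nat.splits)

lemma part_at_Cons_1 [simp]: "part_at (a # r) (Suc 0) = a"
  by (auto simp: part_at_def)

lemma diagram_Suc_Suc [simp]: "(Suc i, Suc j) \<in> diagram (a # r) \<longleftrightarrow> (i, j) \<in> diagram r \<or> i = 0 \<and> 1 \<le> j \<and> j \<le> a"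
  by (cases i) (auto simp: diagram_def)

lemma diagram_zero [simp]: "(0, j) \<notin> diagram l" "(i, 0) \<notin> diagram l"
  by (auto simp: diagram_def)

lemma finite_diagram [simp]: "finite (diagram l)"
proof -
  have "diagram l \<subseteq> (SIGMA i:{1..length l}. {..i + part_at l i})"
    by (auto simp: diagram_def)
  then show ?thesis by (rule finite_subset) auto
qed

lemma diagram_Cons:
  "diagram (a # r) = (\<lambda>k. (Suc 0, Suc k)) ` {1..a} \<union> (\<lambda>(i, j). (Suc i, Suc j)) ` diagram r"
proof (rule set_eqI, clarify)
  fix i j
  show "(i, j) \<in> diagram (a # r) \<longleftrightarrow> (i, j) \<in> (\<lambda>k. (Suc 0, Suc k)) ` {1..a} \<union> (\<lambda>(i, j). (Suc i, Suc j)) ` diagram r"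
    by (cases i; cases j) (auto simp: image_iff)
qed

text \<open>Removing the first row moves the rest of the diagram diagonally. The summand
  \<open>part_at l j\<close> of the hook moves along, because its index is a column and columns
  shift by one as well.\<close>

lemma hook_Suc_Suc:
  assumes "(i, j) \<in> diagram r"
  shows "hook (a # r) (Suc i, Suc j) = hook r (i, j)"
proof -
  have ij: "i \<ge> 1" "j \<ge> 1" using assms by (auto simp: diagram_def)
  have 1: "{j'. (Suc i, j') \<in> diagram (a # r) \<and> j' > Suc j} = Suc ` {j'. (i, j') \<in> diagram r \<and> j' > j}"
  proof (rule set_eqI)
    fix x show "x \<in> {j'. (Suc i, j') \<in> diagram (a # r) \<and> j' > Suc j} \<longleftrightarrow> x \<in> Suc ` {j'. (i, j') \<in> diagram r \<and> j' > j}"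
      using ij by (cases x) (auto simp: image_iff)
  qed
  have 2: "{i'. (i', Suc j) \<in> diagram (a # r) \<and> i' > Suc i} = Suc ` {i'. (i', j) \<in> diagram r \<and> i' > i}"
  proof (rule set_eqI)
    fix x show "x \<in> {i'. (i', Suc j) \<in> diagram (a # r) \<and> i' > Suc i} \<longleftrightarrow> x \<in> Suc ` {i'. (i', j) \<in> diagram r \<and> i' > i}"
      using ij by (cases x) (auto simp: image_iff)
  qed
  show ?thesis using ij
    unfolding hook_def prod.case 1 2 by (simp add: card_image)
qed

lemma hook_first_row:
  assumes "1 \<le> k" "k \<le> a"
  shows "hook (a # r) (Suc 0, Suc k) = a - k + card {i. (i, k) \<in> diagram r} + 1 + part_at r k"
proof -
  have 1: "{j'. (Suc 0, j') \<in> diagram (a # r) \<and> j' > Suc k} = Suc ` {k<..a}"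
  proof (rule set_eqI)
    fix x show "x \<in> {j'. (Suc 0, j') \<in> diagram (a # r) \<and> j' > Suc k} \<longleftrightarrow> x \<in> Suc ` {k<..a}"
      by (cases x) (auto simp: image_iff)
  qed
  have 2: "{i'. (i', Suc k) \<in> diagram (a # r) \<and> i' > Suc 0} = Suc ` {i'. (i', k) \<in> diagram r}"
  proof (rule set_eqI)
    fix x show "x \<in> {i'. (i', Suc k) \<in> diagram (a # r) \<and> i' > Suc 0} \<longleftrightarrow> x \<in> Suc ` {i'. (i', k) \<in> diagram r}"
      by (cases x) (auto simp: image_iff intro: gr0I)
  qed
  show ?thesis using assms
    unfolding hook_def prod.case 1 2 by (simp add: card_image)
qed

text \<open>Row \<open>i\<close> ends in column \<open>i + part_at r i\<close>, so a strict drop of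
  the parts is a weak drop of the row ends. Later statements on which rows reach a given column rest
  on this.\<close>

lemma part_at_shift_mono:
  assumes "strict_part r" "1 \<le> i" "i \<le> j" "j \<le> length r"
  shows "j + part_at r j \<le> i + part_at r i"
  using assms(3,4)
proof (induction j rule: dec_induct)
  case (step j)
  have "r ! j < r ! (j - 1)"
    using assms(1,2) step sorted_wrt_nth_less[of "(>)" r "j - 1" j] by (auto simp: strict_part_def)
  then show ?case using step assms(2) by (auto simp: part_at_def)
qed auto

lemma part_at_pos: "strict_part r \<Longrightarrow> 1 \<le> i \<Longrightarrow> i \<le> length r \<Longrightarrow> 0 < part_at r i"
  by (auto simp: strict_part_def part_at_def)

lemma strict_part_distinct: "strict_part r \<Longrightarrow> distinct r"
  by (induction r) auto

lemma strict_part_pos: "strict_part r \<Longrightarrow> b \<in> set r \<Longrightarrow> 0 < b"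
  by (auto simp: strict_part_def)

lemma bij_part_at:
  assumes "strict_part r"
  shows "bij_betw (part_at r) {1..length r} (set r)"
proof -
  have "bij_betw (\<lambda>i. r ! (i - 1)) {1..length r} (set r)"
  proof (rule bij_betw_trans[of "\<lambda>i. i - 1" _ "{..<length r}" "(!) r", unfolded comp_def])
    show "bij_betw (\<lambda>i. i - 1) {1..length r} {..<length r}"
      by (rule bij_betw_byWitness[where f' = Suc]) auto
    show "bij_betw ((!) r) {..<length r} (set r)"
      using strict_part_distinct[OF assms] by (rule bij_betw_nth) auto
  qed
  moreover have "bij_betw (part_at r) {1..length r} (set r) \<longleftrightarrow> bij_betw (\<lambda>i. r ! (i - 1)) {1..length r} (set r)"
    by (rule bij_betw_cong) (auto simp: part_at_def)
  ultimately show ?thesis by simp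
qed

lemma strict_part_length_le:
  assumes "strict_part r" "\<forall>b\<in>set r. b < a" "0 < a"
  shows "length r < a"
proof (cases r)
  case (Cons b s)
  have "length r + part_at r (length r) \<le> 1 + part_at r 1"
    using assms Cons by (intro part_at_shift_mono) auto
  moreover have "0 < part_at r (length r)" using assms Cons by (intro part_at_pos) auto
  moreover have "part_at r 1 < a" using assms Cons by auto
  ultimately show ?thesis by simp
qed (use assms in auto)

text \<open>For \<open>k \<le> length r\<close> the hooks are the sums \<open>a + b\<close> with
  \<open>b\<close> a part of \<open>r\<close>; for the other \<open>k\<close> they are the numbers
  from 1 to \<open>a\<close> that are not of the form \<open>a - b\<close>. Multiplying by the
  missing factors completes \<open>fact a\<close> and avoids division of natural numbers.\<close>

lemma prod_first_row_hooks:
  assumes "strict_part (a # r)"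
  shows "(\<Prod>k=1..a. hook (a # r) (Suc 0, Suc k)) * (\<Prod>b\<in>set r. a - b) = fact a * (\<Prod>b\<in>set r. a + b)"
proof -
  have r: "strict_part r" "\<And>b. b \<in> set r \<Longrightarrow> b < a" "0 < a" using assms by auto
  let ?n = "length r"
  have n: "?n < a" using strict_part_length_le[OF r(1)] r(2,3) by blast
  have pa: "part_at r i < a" for i using r by (auto simp: part_at_def)
  \<comment> \<open>Even the last row ends beyond column \<open>length r\<close>, so every row
    \<open>i < k\<close> reaches column \<open>k\<close>; these \<open>k - 1\<close> boxes and the
    summand 1 make up for the \<open>- k\<close>.\<close>
  have low: "hook (a # r) (Suc 0, Suc k) = a + part_at r k" if "1 \<le> k" "k \<le> ?n" for k
  proof -
    have "k \<le> i + part_at r i" if "1 \<le> i" "i < k" for i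
      using part_at_shift_mono[OF r(1), of i ?n] part_at_pos[OF r(1), of ?n] that \<open>k \<le> ?n\<close> by linarith
    then have "{i. (i, k) \<in> diagram r} = {1..<k}"
      using \<open>k \<le> ?n\<close> by (auto simp: diagram_def)
    then show ?thesis using that n hook_first_row[of k a r] by simp
  qed
  define N where "N = (\<lambda>k. card {i. (i, k) \<in> diagram r})"
  define g where "g = (\<lambda>k. a - k + N k + 1)"
  have high: "hook (a # r) (Suc 0, Suc k) = g k" if "?n < k" "k \<le> a" for k
    using that by (subst hook_first_row) (auto simp: part_at_def g_def N_def)
  have D: "{i. (i, k) \<in> diagram r} = {i. 1 \<le> i \<and> i \<le> ?n \<and> k \<le> i + part_at r i}" if "?n < k" for k
    using that by (auto simp: diagram_def)
  have Nanti: "N k' \<le> N k" if "?n < k" "k \<le> k'" for k k'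
    unfolding N_def using that by (intro card_mono) (auto simp: D)
  have Nle: "N k \<le> ?n" if "?n < k" for k
  proof -
    have "{i. (i, k) \<in> diagram r} \<subseteq> {1..?n}" using that by (auto simp: D)
    from card_mono[OF _ this] show ?thesis by (simp add: N_def)
  qed
  have gdec: "g k' < g k" if "?n < k" "k < k'" "k' \<le> a" for k k'
    using Nanti[of k k'] that by (auto simp: g_def)
  have inj: "inj_on g {?n<..a}"
    by (rule linorder_inj_onI') (use gdec in force)
  \<comment> \<open>Row \<open>j\<close>, with part \<open>b\<close>, ends in column
    \<open>b + j\<close>. If it reaches column \<open>k\<close>, so do all rows above it and the
    hook exceeds \<open>a - b\<close>; otherwise fewer than \<open>j\<close> rows reach it and the
    hook is below \<open>a - b\<close>.\<close>
  have avoid: "g k \<noteq> a - b" if k: "?n < k" "k \<le> a" and b: "b \<in> set r" for k b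
  proof -
    obtain j where j: "1 \<le> j" "j \<le> ?n" "b = part_at r j"
      using bij_betw_imp_surj_on[OF bij_part_at[OF r(1)], symmetric] b by auto
    show ?thesis
    proof (cases "k \<le> b + j")
      case True
      have "i \<le> j \<Longrightarrow> 1 \<le> i \<Longrightarrow> k \<le> i + part_at r i" for i
        using part_at_shift_mono[OF r(1), of i j] j True by linarith
      then have "{1..j} \<subseteq> {i. (i, k) \<in> diagram r}" using j k by (auto simp: D)
      from card_mono[OF _ this] have "j \<le> N k" using k by (simp add: N_def D)
      then show ?thesis using True k r(2)[OF b] by (auto simp: g_def)
    next
      case False
      have "i < j" if "1 \<le> i" "i \<le> ?n" "k \<le> i + part_at r i" for i
        using part_at_shift_mono[OF r(1), of j i] that j False by (cases "i < j") auto
      then have "{i. (i, k) \<in> diagram r} \<subseteq> {1..<j}" using k by (auto simp: D)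
      from card_mono[OF _ this] have "N k \<le> j - 1" by (simp add: N_def)
      then show ?thesis using False k j r(2)[OF b] by (auto simp: g_def)
    qed
  qed
  have injm: "inj_on (\<lambda>b. a - b) (set r)"
    using r(2) by (intro inj_onI) (metis diff_diff_cancel less_imp_le)
  have sub: "g ` {?n<..a} \<subseteq> {1..a} - (\<lambda>b. a - b) ` set r"
  proof (clarsimp, intro conjI)
    fix k assume k: "?n < k" "k \<le> a"
    show "Suc 0 \<le> g k" by (simp add: g_def)
    show "g k \<le> a" using Nle[OF k(1)] k by (simp add: g_def)
    show "g k \<notin> (\<lambda>b. a - b) ` set r" using avoid[OF k] by auto
  qed
  have subm: "(\<lambda>b. a - b) ` set r \<subseteq> {1..a}" using r(2) by (fastforce simp: Suc_le_eq)
  \<comment> \<open>These are \<open>a - length r\<close> distinct values inside a set of just that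
    size.\<close>
  have eq: "g ` {?n<..a} = {1..a} - (\<lambda>b. a - b) ` set r"
  proof (rule card_subset_eq[OF _ sub])
    have "card ((\<lambda>b. a - b) ` set r) = ?n"
      using injm strict_part_distinct[OF r(1)] by (simp add: card_image distinct_card)
    then show "card (g ` {?n<..a}) = card ({1..a} - (\<lambda>b. a - b) ` set r)"
      using subm inj by (simp add: card_image card_Diff_subset)
  qed auto
  have "(\<Prod>k\<in>{?n<..a}. g k) * (\<Prod>b\<in>set r. a - b) = \<Prod>({1..a} - (\<lambda>b. a - b) ` set r) * \<Prod>((\<lambda>b. a - b) ` set r)"
    unfolding eq[symmetric] using inj injm by (simp add: prod.reindex)
  also have "\<dots> = fact a"
    using prod.subset_diff[OF subm, of "\<lambda>x. x"] by (simp add: fact_prod)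
  finally have *: "(\<Prod>k\<in>{?n<..a}. g k) * (\<Prod>b\<in>set r. a - b) = fact a" .
  have "(\<Prod>k=1..a. hook (a # r) (Suc 0, Suc k)) =
    (\<Prod>k=1..?n. hook (a # r) (Suc 0, Suc k)) * (\<Prod>k\<in>{?n<..a}. hook (a # r) (Suc 0, Suc k))"
    using n by (subst prod.union_disjoint[symmetric]) (auto intro!: prod.cong)
  also have "(\<Prod>k=1..?n. hook (a # r) (Suc 0, Suc k)) = (\<Prod>k=1..?n. a + part_at r k)"
    using low by simp
  also have "\<dots> = (\<Prod>b\<in>set r. a + b)"
    by (rule prod.reindex_bij_betw[OF bij_part_at[OF r(1)]])
  also have "(\<Prod>k\<in>{?n<..a}. hook (a # r) (Suc 0, Suc k)) = (\<Prod>k\<in>{?n<..a}. g k)"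
    using high by simp
  finally show ?thesis using * by (simp add: algebra_simps)
qed

lemma H_Cons:
  assumes "strict_part (a # r)"
  shows "real (H (a # r)) = fact a * (\<Prod>b\<in>set r. (real a + real b) / (real a - real b)) * real (H r)"
proof -
  have "H (a # r) = (\<Prod>k=1..a. hook (a # r) (Suc 0, Suc k)) * (\<Prod>b\<in>diagram r. hook r b)"
    unfolding H_def diagram_Cons
  proof (subst prod.union_disjoint)
    have "(\<Prod>b\<in>(\<lambda>(i, j). (Suc i, Suc j)) ` diagram r. hook (a # r) b) = (\<Prod>b\<in>diagram r. hook r b)"
      by (subst prod.reindex) (auto simp: inj_on_def hook_Suc_Suc intro!: prod.cong)
    then show "(\<Prod>b\<in>(\<lambda>k. (Suc 0, Suc k)) ` {1..a}. hook (a # r) b) *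
        (\<Prod>b\<in>(\<lambda>(i, j). (Suc i, Suc j)) ` diagram r. hook (a # r) b) =
      (\<Prod>k=1..a. hook (a # r) (Suc 0, Suc k)) * (\<Prod>b\<in>diagram r. hook r b)"
      by (simp add: prod.reindex inj_on_def)
  qed auto
  then have "H (a # r) * (\<Prod>b\<in>set r. a - b) = fact a * (\<Prod>b\<in>set r. a + b) * H r"
    using prod_first_row_hooks[OF assms] by (simp add: H_def algebra_simps)
  then have "real (H (a # r) * (\<Prod>b\<in>set r. a - b)) = real (fact a * (\<Prod>b\<in>set r. a + b) * H r)"
    by simp
  moreover have "real (\<Prod>b\<in>set r. a - b) = (\<Prod>b\<in>set r. real a - real b)"
    unfolding of_nat_prod using assms by (intro prod.cong) (auto simp: of_nat_diff)
  moreover have "(\<Prod>b\<in>set r. real a - real b) \<noteq> 0" using assms by auto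
  ultimately show ?thesis by (simp add: prod_dividef field_simps)
qed

lemma H_pos: "strict_part l \<Longrightarrow> 0 < real (H l)"
proof (induction l)
  case Nil
  have "diagram [] = {}" by (auto simp: diagram_def)
  then show ?case by (simp add: H_def)
next
  case (Cons a r)
  have "0 < (\<Prod>b\<in>set r. (real a + real b) / (real a - real b))"
    using Cons.prems by (intro prod_pos) auto
  then show ?case using Cons by (simp add: H_Cons del: of_nat_0_less_iff)
qed

section \<open>Adding a box\<close>

lemma contains_Nil [simp]: "contains k []"
  by (simp add: contains_def part_at_def)

lemma contains_Nil_Cons [simp]: "0 < a \<Longrightarrow> \<not> contains [] (a # r)"
  by (auto simp: contains_def part_at_def intro!: exI[of _ 1])

lemma contains_Cons_Cons [simp]: "contains (b # k) (a # r) \<longleftrightarrow> a \<le> b \<and> contains k r"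
proof
  assume *: "contains (b # k) (a # r)"
  have "part_at r i \<le> part_at k i" for i
    using *[unfolded contains_def, rule_format, of "Suc i"] by (cases i) (auto simp: part_at_def)
  moreover have "a \<le> b" using *[unfolded contains_def, rule_format, of 1] by simp
  ultimately show "a \<le> b \<and> contains k r" by (auto simp: contains_def)
next
  assume *: "a \<le> b \<and> contains k r"
  have "part_at (a # r) i \<le> part_at (b # k) i" for i
  proof (cases i)
    case (Suc j)
    then show ?thesis using * by (cases j) (auto simp: contains_def)
  qed (simp add: part_at_def)
  then show "contains (b # k) (a # r)" by (simp add: contains_def)
qed

lemma contains_refl: "contains l l"
  by (simp add: contains_def)

lemma contains_sum_le: "strict_part l \<Longrightarrow> contains k l \<Longrightarrow> sum_list l \<le> sum_list k"
proof (induction l arbitrary: k)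
  case (Cons a r)
  then show ?case by (cases k) (auto intro: add_mono)
qed auto

lemma contains_sum_eq:
  "strict_part l \<Longrightarrow> strict_part k \<Longrightarrow> contains k l \<Longrightarrow> sum_list k = sum_list l \<Longrightarrow> k = l"
proof (induction l arbitrary: k)
  case Nil
  then show ?case by (cases k) auto
next
  case (Cons a r)
  then obtain b s where k: "k = b # s" by (cases k) auto
  then have "sum_list r \<le> sum_list s" using Cons.prems contains_sum_le by auto
  then have "b = a" "sum_list s = sum_list r" using Cons.prems k by auto
  then show ?case using Cons k by auto
qed

text \<open>The index \<open>i\<close> is the part being enlarged; \<open>i = 0\<close> stands for opening a new row, so that the
  added box has content \<open>i + 1\<close> in both cases.\<close>
definition grow :: "nat \<Rightarrow> nat list \<Rightarrow> nat list" where
  "grow i l = (if i = 0 then l @ [1] else map (\<lambda>b. if b = i then i + 1 else b) l)"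

lemma grow_notin: "i \<noteq> 0 \<Longrightarrow> i \<notin> set l \<Longrightarrow> grow i l = l"
  by (auto simp: grow_def intro: map_idI)

lemma grow_Cons: "strict_part (a # r) \<Longrightarrow> grow i (a # r) = (if i = a then (a + 1) # r else a # grow i r)"
  using grow_notin[of a r] by (auto simp: grow_def)

lemma length_grow: "length (grow i l) = (if i = 0 then length l + 1 else length l)"
  by (simp add: grow_def)

lemma set_grow: "strict_part l \<Longrightarrow> i \<in> insert 0 (set l) \<Longrightarrow> set (grow i l) = insert (i + 1) (set l - {i})"
  using strict_part_pos[of l] by (auto simp: grow_def)

text \<open>The extra unit goes either to the first row, and then the other rows agree by
  \<open>contains_sum_eq\<close>, or further down. Strictness of \<open>k\<close> excludes zero
  parts, so a new row can only be \<open>[1]\<close>.\<close>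

lemma contains_sum_Suc_iff:
  assumes "strict_part l" "strict_part k"
  shows "contains k l \<and> sum_list k = sum_list l + 1 \<longleftrightarrow> (\<exists>i\<in>insert 0 (set l). k = grow i l)"
  using assms
proof (induction l arbitrary: k)
  case Nil
  then show ?case
  proof (cases k)
    case (Cons b s)
    then have "sum_list k = 1 \<longleftrightarrow> k = [1]"
      using Nil strict_part_pos[of s] by (cases s) auto
    then show ?thesis by (simp add: grow_def)
  qed (simp add: grow_def)
next
  case (Cons a r)
  show ?case
  proof (cases k)
    case (Cons b s)
    have r: "strict_part r" "strict_part s" using Cons.prems Cons by auto
    have a0: "a \<noteq> 0" "a \<notin> set r" using Cons.prems by auto
    have "contains k (a # r) \<and> sum_list k = sum_list (a # r) + 1 \<longleftrightarrow>
      b = a \<and> contains s r \<and> sum_list s = sum_list r + 1 \<or> b = a + 1 \<and> s = r"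
    proof -
      have "a \<le> b \<and> contains s r \<and> b + sum_list s = a + sum_list r + 1 \<longleftrightarrow>
        contains s r \<and> (b = a \<and> sum_list s = sum_list r + 1 \<or> b = a + 1 \<and> sum_list s = sum_list r)"
        using contains_sum_le[OF r(1), of s] by auto
      moreover have "contains s r \<and> sum_list s = sum_list r \<longleftrightarrow> s = r"
        using contains_sum_eq[OF r] contains_refl[of r] by auto
      ultimately show ?thesis using Cons by auto
    qed
    also have "\<dots> \<longleftrightarrow> b = a \<and> (\<exists>i\<in>insert 0 (set r). s = grow i r) \<or> b = a + 1 \<and> s = r"
      using Cons.IH[OF r] by simp
    also have "\<dots> \<longleftrightarrow> (\<exists>i\<in>insert 0 (set (a # r)). k = grow i (a # r))"
      using a0 unfolding grow_Cons[OF Cons.prems(1)] Cons by auto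
    finally show ?thesis .
  qed (use Cons.prems in \<open>auto simp: grow_def\<close>)
qed

lemma strict_part_grow:
  assumes "strict_part l" "i \<in> insert 0 (set l)"
  shows "strict_part (grow i l) \<longleftrightarrow> i + 1 \<notin> set l"
proof (cases "i = 0")
  case True
  then show ?thesis using assms
    by (auto simp: strict_part_def grow_def sorted_wrt_append) (metis One_nat_def Suc_lessI)
next
  case False
  then obtain xs ys where l: "l = xs @ i # ys" using assms by (auto simp: in_set_conv_decomp)
  have "i \<notin> set xs" "i \<notin> set ys" using strict_part_distinct[OF assms(1)] l by auto
  then have "grow i l = xs @ (i + 1) # ys" using False l by (auto simp: grow_def intro: map_idI)
  moreover have "(\<forall>x\<in>set xs. i + 1 < x) \<longleftrightarrow> i + 1 \<notin> set xs" if "\<forall>x\<in>set xs. i < x"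
    using that by (metis Suc_eq_plus1 Suc_lessI less_irrefl)
  ultimately show ?thesis using assms(1) l
    by (auto simp: strict_part_def sorted_wrt_append)
qed

lemma plus_boxes_eq:
  assumes "strict_part l"
  shows "plus_boxes l = (\<lambda>i. grow i l) ` {i \<in> insert 0 (set l). i + 1 \<notin> set l}"
  using contains_sum_Suc_iff[OF assms] strict_part_grow[OF assms] unfolding plus_boxes_def by blast

lemma inj_on_grow:
  assumes "strict_part l"
  shows "inj_on (\<lambda>i. grow i l) (insert 0 (set l))"
proof (rule inj_onI)
  fix i j assume *: "i \<in> insert 0 (set l)" "j \<in> insert 0 (set l)" "grow i l = grow j l"
  then have S: "insert (i + 1) (set l - {i}) = insert (j + 1) (set l - {j})"
    using arg_cong[OF *(3), of set] set_grow[OF assms *(1)] set_grow[OF assms *(2)] by simp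
  have z: "i = 0 \<longleftrightarrow> j = 0"
    using arg_cong[OF *(3), of length] by (auto simp: length_grow split: if_splits)
  show "i = j"
  proof (rule ccontr)
    assume "i \<noteq> j"
    then have "i \<in> insert (j + 1) (set l - {j})" using *(1) z by auto
    then show False unfolding S[symmetric] by simp
  qed
qed

lemma sum_plus_boxes:
  assumes "strict_part l"
  shows "(\<Sum>k\<in>{k\<in>plus_boxes l. length k > length l}. G k) + 2 * (\<Sum>k\<in>{k\<in>plus_boxes l. length k = length l}. G k)
    = (\<Sum>i\<in>{i \<in> insert 0 (set l). i + 1 \<notin> set l}. (if i = 0 then 1 else 2) * G (grow i l) :: real)"
proof -
  let ?A = "{i \<in> insert 0 (set l). i + 1 \<notin> set l}"
  have P: "{k\<in>plus_boxes l. length k > length l} = (\<lambda>i. grow i l) ` {i \<in> ?A. i = 0}"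
    "{k\<in>plus_boxes l. length k = length l} = (\<lambda>i. grow i l) ` {i \<in> ?A. i \<noteq> 0}"
    unfolding plus_boxes_eq[OF assms] by (auto simp: length_grow split: if_splits)
  have "(\<Sum>k\<in>{k\<in>plus_boxes l. length k > length l}. G k) = (\<Sum>i\<in>{i \<in> ?A. i = 0}. G (grow i l))"
    unfolding P(1) by (rule sum.reindex[unfolded comp_def], rule inj_on_subset[OF inj_on_grow[OF assms]]) auto
  moreover have "(\<Sum>k\<in>{k\<in>plus_boxes l. length k = length l}. G k) = (\<Sum>i\<in>{i \<in> ?A. i \<noteq> 0}. G (grow i l))"
    unfolding P(2) by (rule sum.reindex[unfolded comp_def], rule inj_on_subset[OF inj_on_grow[OF assms]]) auto
  ultimately have "(\<Sum>k\<in>{k\<in>plus_boxes l. length k > length l}. G k) + 2 * (\<Sum>k\<in>{k\<in>plus_boxes l. length k = length l}. G k) =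
    (\<Sum>i\<in>{i \<in> ?A. i = 0}. G (grow i l)) + 2 * (\<Sum>i\<in>{i \<in> ?A. i \<noteq> 0}. G (grow i l))"
    by (simp only:)
  also have "\<dots> = (\<Sum>i\<in>{i \<in> ?A. i = 0} \<union> {i \<in> ?A. i \<noteq> 0}. (if i = 0 then 1 else 2) * G (grow i l))"
    by (subst sum.union_disjoint) (auto simp: sum_distrib_left)
  also have "\<dots> = (\<Sum>i\<in>?A. (if i = 0 then 1 else 2) * G (grow i l))"
    by (rule sum.cong) auto
  finally show ?thesis .
qed

section \<open>Hook products over sets of parts, and the growth weights\<close>

text \<open>The classical product formula for the hooks of a shifted shape, taken over a set:
  growing a part then means deleting one element and inserting another, with no regard to the order
  of the list.\<close>

definition hook_prod :: "nat set \<Rightarrow> real" where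
  "hook_prod S = (\<Prod>a\<in>S. fact a * (\<Prod>b\<in>{b \<in> S. b < a}. (real a + real b) / (real a - real b)))"

text \<open>The new element is the larger one in some pairs and the smaller one in the others; the
  absolute value covers both.\<close>

lemma hook_prod_insert:
  assumes "finite S" "x \<notin> S"
  shows "hook_prod (insert x S) = fact x * (\<Prod>b\<in>S. (real x + real b) / \<bar>real x - real b\<bar>) * hook_prod S"
proof -
  let ?f = "\<lambda>a b. (real a + real b) / (real a - real b)"
  have 1: "(\<Prod>b\<in>{b \<in> insert x S. b < x}. ?f x b) = (\<Prod>b\<in>S. if b < x then ?f x b else 1)"
    using assms by (subst prod.inter_filter[symmetric]) (auto intro!: prod.cong)
  have 2: "(\<Prod>b\<in>{b \<in> insert x S. b < a}. ?f a b) = (if x < a then ?f a x else 1) * (\<Prod>b\<in>{b \<in> S. b < a}. ?f a b)"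
    if "a \<in> S" for a
  proof -
    have "{b \<in> insert x S. b < a} = (if x < a then insert x {b \<in> S. b < a} else {b \<in> S. b < a})" by auto
    then show ?thesis using assms by simp
  qed
  have "hook_prod (insert x S) = fact x * (\<Prod>b\<in>S. if b < x then ?f x b else 1) *
    (\<Prod>a\<in>S. (if x < a then ?f a x else 1) * (fact a * (\<Prod>b\<in>{b \<in> S. b < a}. ?f a b)))"
    unfolding hook_prod_def using assms 1 2 by (simp add: mult_ac)
  also have "\<dots> = fact x * (\<Prod>b\<in>S. (if b < x then ?f x b else 1) * (if x < b then ?f b x else 1)) * hook_prod S"
    by (simp add: hook_prod_def prod.distrib mult_ac)
  also have "(\<Prod>b\<in>S. (if b < x then ?f x b else 1) * (if x < b then ?f b x else 1)) =
     (\<Prod>b\<in>S. (real x + real b) / \<bar>real x - real b\<bar>)"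
    using assms by (intro prod.cong) (auto simp: add_ac)
  finally show ?thesis .
qed

lemma H_eq_hook_prod: "strict_part l \<Longrightarrow> real (H l) = hook_prod (set l)"
proof (induction l)
  case Nil
  have "diagram [] = {}" by (auto simp: diagram_def)
  then show ?case by (simp add: H_def hook_prod_def)
next
  case (Cons a r)
  then have a: "a \<notin> set r" "\<And>b. b \<in> set r \<Longrightarrow> b < a" by auto
  have "hook_prod (set (a # r)) = fact a * (\<Prod>b\<in>set r. (real a + real b) / \<bar>real a - real b\<bar>) * hook_prod (set r)"
    using a(1) by (simp add: hook_prod_insert)
  also have "(\<Prod>b\<in>set r. (real a + real b) / \<bar>real a - real b\<bar>) = (\<Prod>b\<in>set r. (real a + real b) / (real a - real b))"
    using a(2) by (intro prod.cong refl) (simp add: less_imp_le)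
  finally show ?case using Cons by (simp add: H_Cons)
qed

text \<open>The residue at \<open>t = binom2 (i + 1)\<close> described in the header; it vanishes when \<open>i + 1 \<in> S\<close>, that is,
  when no box can be added there.\<close>
definition growth_weight :: "nat set \<Rightarrow> nat \<Rightarrow> real" where
  "growth_weight S i = (\<Prod>b\<in>S. binom2 (int i + 1) - binom2 (int b)) /
     (\<Prod>j\<in>insert 0 S - {i}. binom2 (int i + 1) - binom2 (int j + 1))"

lemma growth_weight_eq_0: "finite S \<Longrightarrow> i + 1 \<in> S \<Longrightarrow> growth_weight S i = 0"
proof -
  assume *: "finite S" "i + 1 \<in> S"
  then have "(\<Prod>b\<in>S. binom2 (int i + 1) - binom2 (int b)) = 0"
    by (intro prod_zero bexI[of _ "i + 1"]) (auto simp: add.commute)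
  then show ?thesis by (simp add: growth_weight_def)
qed

text \<open>Only factors involving \<open>i\<close> or \<open>i + 1\<close> survive in the quotient.
  They match the weight through \<open>binom2 (i + 1) - binom2 b = (i + b) * (i + 1 - b) / 2\<close>
  and \<open>binom2 (i + 1) - binom2 (b + 1) = (i + b + 1) * (i - b) / 2\<close>.\<close>

lemma growth_weight_eq:
  assumes "strict_part l" "i \<in> insert 0 (set l)" "i + 1 \<notin> set l"
  shows "(if i = 0 then 1 else 2) * (H l / H (grow i l)) = growth_weight (set l) i"
proof -
  have str: "strict_part (grow i l)" using strict_part_grow assms by blast
  define R where "R = set l - {i}"
  have R: "finite R" "i \<notin> R" "i + 1 \<notin> R" "0 \<notin> R"
    using assms strict_part_pos[OF assms(1), of 0] by (auto simp: R_def)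
  have Hg: "H (grow i l) = fact (i + 1) * (\<Prod>b\<in>R. (real (i + 1) + real b) / \<bar>real (i + 1) - real b\<bar>) * hook_prod R"
    using R unfolding H_eq_hook_prod[OF str] set_grow[OF assms(1,2)] R_def[symmetric]
    by (simp add: hook_prod_insert)
  show ?thesis
  proof (cases "i = 0")
    case True
    then have "R = set l" using R(4) strict_part_pos[OF assms(1), of 0] by (auto simp: R_def)
    then have Hl: "H l = hook_prod R" using H_eq_hook_prod[OF assms(1)] by simp
    have "hook_prod R \<noteq> 0" using H_pos[OF assms(1)] Hl by simp
    then have "H l / H (grow i l) = (\<Prod>b\<in>R. \<bar>real (i + 1) - real b\<bar> / (real (i + 1) + real b))"
      unfolding Hl Hg using True by (simp add: prod_dividef)
    also have "\<dots> = (\<Prod>b\<in>R. (binom2 (int i + 1) - binom2 (int b)) / (binom2 (int i + 1) - binom2 (int b + 1)))"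
    proof (rule prod.cong)
      fix b assume b: "b \<in> R"
      have "b \<noteq> 0" using b R(4) by metis
      moreover have "b \<noteq> 1" using b R(3) True by auto
      ultimately have "b \<ge> 2" by linarith
      then show "\<bar>real (i + 1) - real b\<bar> / (real (i + 1) + real b) =
        (binom2 (int i + 1) - binom2 (int b)) / (binom2 (int i + 1) - binom2 (int b + 1))"
      proof -
        have "binom2 (int i + 1) - binom2 (int b) = - (real b / 2) * (real b - 1)"
          "binom2 (int i + 1) - binom2 (int b + 1) = - (real b / 2) * (real b + 1)"
          using True by (simp_all add: binom2_def field_simps)
        then show ?thesis using True b \<open>b \<ge> 2\<close> by (simp add: add.commute)
      qed
    qed auto
    also have "\<dots> = growth_weight (set l) i"
    proof -
      have "insert 0 (set l) - {i} = set l" using True \<open>R = set l\<close> R(4) by auto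
      then show ?thesis by (simp only: growth_weight_def prod_dividef \<open>R = set l\<close>)
    qed
    finally show ?thesis using True by simp
  next
    case False
    then have S: "set l = insert i R" "i > 0" using assms by (auto simp: R_def)
    have Hl: "H l = fact i * (\<Prod>b\<in>R. (real i + real b) / \<bar>real i - real b\<bar>) * hook_prod R"
      using R by (simp add: H_eq_hook_prod[OF assms(1)] S hook_prod_insert)
    have ne: "hook_prod R \<noteq> 0" using H_pos[OF assms(1)] Hl by auto
    have "2 * (H l / H (grow i l)) = 2 * (fact i / fact (i + 1)) *
      ((\<Prod>b\<in>R. (real i + real b) / \<bar>real i - real b\<bar>) / (\<Prod>b\<in>R. (real (i + 1) + real b) / \<bar>real (i + 1) - real b\<bar>))"
      unfolding Hl Hg using ne by simp
    \<comment> \<open>The numerator factor for \<open>b = i\<close> over the denominator factor for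
      \<open>j = 0\<close>, where \<open>binom2 1 = 0\<close>. This pair is the source of the
      doubling for boxes that open no new row.\<close>
    also have "2 * (fact i / fact (i + 1)) = (binom2 (int i + 1) - binom2 (int i)) / binom2 (int i + 1)"
    proof -
      have "2 * (fact i / fact (i + 1)) = 2 / (real i + 1)" by (simp add: divide_simps)
      also have "\<dots> = (binom2 (int i + 1) - binom2 (int i)) / binom2 (int i + 1)"
        using S(2) by (simp add: binom2_def divide_simps) (simp add: algebra_simps)
      finally show ?thesis .
    qed
    also have "(\<Prod>b\<in>R. (real i + real b) / \<bar>real i - real b\<bar>) / (\<Prod>b\<in>R. (real (i + 1) + real b) / \<bar>real (i + 1) - real b\<bar>)
      = (\<Prod>b\<in>R. (binom2 (int i + 1) - binom2 (int b)) / (binom2 (int i + 1) - binom2 (int b + 1)))"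
      unfolding prod_dividef[symmetric]
    proof (rule prod.cong)
      fix b assume b: "b \<in> R"
      have u: "binom2 (int i + 1) - binom2 (int b) = (real i + real b) * (real (i + 1) - real b) / 2"
        "binom2 (int i + 1) - binom2 (int b + 1) = (real (i + 1) + real b) * (real i - real b) / 2"
        by (simp_all add: binom2_def field_simps)
      \<comment> \<open>Hence \<open>i - b\<close> and \<open>i + 1 - b\<close> have the same sign,
        and the absolute values drop out of the quotient.\<close>
      have "b \<noteq> i" "b \<noteq> i + 1" using b R by metis+
      then consider "b < i" | "b > i + 1" by linarith
      then show "(real i + real b) / \<bar>real i - real b\<bar> / ((real (i + 1) + real b) / \<bar>real (i + 1) - real b\<bar>) =
        (binom2 (int i + 1) - binom2 (int b)) / (binom2 (int i + 1) - binom2 (int b + 1))"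
      proof cases
        case 1
        then have "\<bar>real i - real b\<bar> = real i - real b" "\<bar>real (i + 1) - real b\<bar> = real (i + 1) - real b" by auto
        then show ?thesis unfolding u by (simp only:) (simp add: mult_ac)
      next
        case 2
        then have "\<bar>real i - real b\<bar> = - (real i - real b)" "\<bar>real (i + 1) - real b\<bar> = - (real (i + 1) - real b)" by auto
        then show ?thesis unfolding u by (simp only:) (simp only: divide_minus_right minus_divide_divide divide_divide_eq_left divide_divide_eq_right times_divide_eq_left; simp add: mult_ac)
      qed
    qed auto
    also have "(binom2 (int i + 1) - binom2 (int i)) / binom2 (int i + 1) * \<dots> = growth_weight (set l) i"
    proof -
      have "insert 0 (insert i R) - {i} = insert 0 R" using R S(2) by auto
      moreover have "binom2 1 = 0" by (simp add: binom2_def)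
      ultimately show ?thesis unfolding growth_weight_def S(1) using R by (simp add: prod_dividef)
    qed
    finally show ?thesis using False by simp
  qed
qed

lemma Dop_div_H:
  assumes "strict_part l"
  shows "Dop (\<lambda>k. F k / H k) l = ((\<Sum>i\<in>insert 0 (set l). growth_weight (set l) i * F (grow i l)) - F l) / H l"
proof -
  let ?A = "{i \<in> insert 0 (set l). i + 1 \<notin> set l}"
  have "H l * (\<Sum>i\<in>?A. (if i = 0 then 1 else 2) * (F (grow i l) / H (grow i l))) =
     (\<Sum>i\<in>?A. growth_weight (set l) i * F (grow i l))"
    unfolding sum_distrib_left
  proof (intro sum.cong refl)
    fix i assume "i \<in> ?A"
    then have "growth_weight (set l) i = (if i = 0 then 1 else 2) * (H l / H (grow i l))"
      using growth_weight_eq[OF assms, of i] by simp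
    then show "real (H l) * ((if i = 0 then 1 else 2) * (F (grow i l) / real (H (grow i l)))) =
      growth_weight (set l) i * F (grow i l)" by simp
  qed
  \<comment> \<open>Parts that cannot grow enter with weight 0, so the sum takes the form of a full
    partial fraction expansion.\<close>
  also have "\<dots> = (\<Sum>i\<in>insert 0 (set l). growth_weight (set l) i * F (grow i l))"
    by (intro sum.mono_neutral_left) (auto simp: growth_weight_eq_0)
  finally show ?thesis
    unfolding Dop_def sum_plus_boxes[OF assms] using H_pos[OF assms] by (simp add: field_simps)
qed

section \<open>Diagrams of one-box extensions\<close>

text \<open>Beyond the last row \<open>part_at\<close> is 0, which leaves no room for
  \<open>j\<close>; the bound by \<open>length l\<close> is therefore implied.\<close>

lemma part_at_diagram: "(i, j) \<in> diagram l \<longleftrightarrow> 1 \<le> i \<and> i < j \<and> j \<le> i + part_at l i"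
  by (auto simp: diagram_def part_at_def)

text \<open>\<open>r\<close> counts rows from 0, so the box lies in row \<open>r + 1\<close>. Its
  content is \<open>i + 1\<close> for every \<open>r\<close>, which is why the row never enters the
  later computations.\<close>

lemma diagram_grow:
  assumes "strict_part l" "i \<in> insert 0 (set l)"
  obtains r where "r < length (grow i l)" "grow i l ! r = i + 1" "(r + 1, r + i + 2) \<notin> diagram l"
    "diagram (grow i l) = insert (r + 1, r + i + 2) (diagram l)"
proof (cases "i = 0")
  case True
  let ?b = "(length l + 1, length l + 2)"
  have "diagram (grow i l) = insert ?b (diagram l)"
    using True by (auto simp: grow_def diagram_def part_at_def nth_append split: if_splits)
  moreover have "?b \<notin> diagram l" by (auto simp: diagram_def)
  ultimately show ?thesis using that[of "length l"] True by (simp add: grow_def)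
next
  case False
  then obtain r where r: "r < length l" "l ! r = i" using assms by (auto simp: in_set_conv_nth)
  have p: "part_at (grow i l) s = (if s = r + 1 then i + 1 else part_at l s)" for s
    using r False nth_eq_iff_index_eq[OF strict_part_distinct[OF assms(1)], of "s - 1" r]
    by (auto simp: part_at_def grow_def)
  let ?b = "(r + 1, r + i + 2)"
  have pr: "part_at l (r + 1) = i" using r by (simp add: part_at_def)
  have "diagram (grow i l) = insert ?b (diagram l)"
  proof (intro set_eqI, clarify)
    fix a b
    show "(a, b) \<in> diagram (grow i l) \<longleftrightarrow> (a, b) \<in> insert ?b (diagram l)"
      unfolding part_at_diagram p insert_iff prod.inject using pr by (cases "a = r + 1") auto
  qed
  moreover have "?b \<notin> diagram l" using pr by (auto simp: part_at_diagram)
  ultimately show ?thesis using that[of r] False r by (simp add: grow_def)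
qed

lemma contains_iff_diagram: "contains k l \<longleftrightarrow> diagram l \<subseteq> diagram k"
proof
  assume *: "diagram l \<subseteq> diagram k"
  have "part_at l i \<le> part_at k i" for i
  proof (cases "part_at l i = 0")
    case False
    then have "(i, i + part_at l i) \<in> diagram l" by (auto simp: part_at_diagram part_at_def split: if_splits)
    then have "(i, i + part_at l i) \<in> diagram k" using * by blast
    then show ?thesis by (simp add: part_at_diagram)
  qed simp
  then show "contains k l" by (simp add: contains_def)
next
  assume "contains k l"
  then have le: "part_at l i \<le> part_at k i" for i by (simp add: contains_def)
  show "diagram l \<subseteq> diagram k"
    by (auto simp: part_at_diagram intro: order.trans[OF _ add_left_mono[OF le]])
qed

lemma card_diagram: "card (diagram l) = sum_list l"
proof (induction l)
  case Nil
  have "diagram [] = {}" by (auto simp: diagram_def)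
  then show ?case by simp
next
  case (Cons a r)
  have "card (diagram (a # r)) = card ((\<lambda>k. (Suc 0, Suc k)) ` {1..a}) + card ((\<lambda>(i, j). (Suc i, Suc j)) ` diagram r)"
    unfolding diagram_Cons by (intro card_Un_disjoint) auto
  then show ?case using Cons by (simp add: card_image inj_on_def split_def prod_eq_iff)
qed

text \<open>The box form of one-box extensions, shared by the outer corners and by the removal of
  the largest entry of a tableau.\<close>

lemma plus_boxes_iff_diagram:
  "k \<in> plus_boxes l \<longleftrightarrow> strict_part k \<and> (\<exists>b. b \<notin> diagram l \<and> diagram k = insert b (diagram l))"
proof -
  have "diagram l \<subseteq> diagram k \<and> card (diagram k) = card (diagram l) + 1 \<longleftrightarrow>
    (\<exists>b. b \<notin> diagram l \<and> diagram k = insert b (diagram l))"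
  proof (intro iffI conjI)
    assume *: "diagram l \<subseteq> diagram k \<and> card (diagram k) = card (diagram l) + 1"
    then have "card (diagram k - diagram l) = 1" by (simp add: card_Diff_subset)
    then obtain b where "diagram k - diagram l = {b}" by (auto simp: card_1_singleton_iff)
    then show "\<exists>b. b \<notin> diagram l \<and> diagram k = insert b (diagram l)" using * by blast
  next
    assume "\<exists>b. b \<notin> diagram l \<and> diagram k = insert b (diagram l)"
    then obtain b where "b \<notin> diagram l" "diagram k = insert b (diagram l)" by blast
    then show "card (diagram k) = card (diagram l) + 1" by simp
  qed blast
  then show ?thesis by (auto simp: plus_boxes_def contains_iff_diagram card_diagram)
qed

section \<open>The functions \<open>q\<^sub>k\<close> as sums over parts\<close>

text \<open>The inverse of \<open>grow\<close>. A part 1 is lowered by deleting its row, which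
  corresponds to the index 0.\<close>

lemma strict_part_shrink:
  assumes "strict_part l" "c \<in> set l" "c - 1 \<notin> set l"
  obtains k where "strict_part k" "c - 1 \<in> insert 0 (set k)" "c \<notin> set k" "grow (c - 1) k = l"
proof -
  obtain xs ys where l: "l = xs @ c # ys" using assms by (auto simp: in_set_conv_decomp)
  have c: "0 < c" using assms strict_part_pos by blast
  have ys: "\<forall>y\<in>set ys. y < c - 1"
  proof
    fix y assume "y \<in> set ys"
    then have "y < c" "y \<noteq> c - 1" using assms l by (auto simp: strict_part_def sorted_wrt_append)
    then show "y < c - 1" by linarith
  qed
  have xs: "\<forall>x\<in>set xs. c < x" using assms l by (auto simp: strict_part_def sorted_wrt_append)
  show ?thesis
  proof (cases "c = 1")
    case True
    then have "ys = []" using ys by (cases ys) auto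
    moreover have "strict_part xs" using assms l by (auto simp: strict_part_def sorted_wrt_append)
    ultimately show ?thesis using that[of xs] True l xs by (auto simp: grow_def)
  next
    case False
    have "strict_part (xs @ (c - 1) # ys)"
      using assms l c False xs ys by (fastforce simp: strict_part_def sorted_wrt_append)
    moreover have "c \<notin> set (xs @ (c - 1) # ys)" using xs ys c by auto
    moreover have "grow (c - 1) (xs @ (c - 1) # ys) = l"
      using c False xs ys by (auto simp: grow_def l intro!: map_idI)
    ultimately show ?thesis using that by (metis in_set_conv_decomp insertI2)
  qed
qed

text \<open>The rows whose part can be lowered by one. For a strict partition a last part 1 always
  qualifies, as 0 is never a part.\<close>

definition corner_rows :: "nat list \<Rightarrow> nat set" where
  "corner_rows l = {r. 1 \<le> r \<and> r \<le> length l \<and> part_at l r - 1 \<notin> set l}"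

text \<open>Removing a corner undoes the addition of a box, so both inclusions go through a smaller
  strict partition \<open>k\<close> from which \<open>l\<close> arises by
  \<open>grow\<close>.\<close>

lemma outer_corners_eq:
  assumes "strict_part l"
  shows "outer_corners l = (\<lambda>r. (r, r + part_at l r)) ` corner_rows l"
proof (intro equalityI subsetI)
  fix b assume "b \<in> outer_corners l"
  then obtain k where k: "b \<in> diagram l" "strict_part k" "diagram k = diagram l - {b}"
    by (auto simp: outer_corners_def)
  then have b: "b \<notin> diagram k" "diagram l = insert b (diagram k)" by auto
  have "l \<in> plus_boxes k" unfolding plus_boxes_iff_diagram using assms b by blast
  then obtain i where i: "i \<in> insert 0 (set k)" "i + 1 \<notin> set k" "l = grow i k"
    using plus_boxes_eq[OF k(2)] by auto
  obtain r where r: "r < length (grow i k)" "grow i k ! r = i + 1" "(r + 1, r + i + 2) \<notin> diagram k"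
    "diagram (grow i k) = insert (r + 1, r + i + 2) (diagram k)"
    using diagram_grow[OF k(2) i(1)] by blast
  have "b = (r + 1, r + i + 2)"
    using b r(3) r(4)[folded i(3)] by blast
  moreover have "i \<notin> set l" unfolding i(3) set_grow[OF k(2) i(1)] by simp
  moreover have "part_at l (r + 1) = i + 1" using r i by (simp add: part_at_def)
  ultimately show "b \<in> (\<lambda>r. (r, r + part_at l r)) ` corner_rows l"
    using r(1) i(3) by (auto simp: corner_rows_def intro!: image_eqI[of _ _ "r + 1"])
next
  fix b assume "b \<in> (\<lambda>r. (r, r + part_at l r)) ` corner_rows l"
  then obtain s where s: "1 \<le> s" "s \<le> length l" "part_at l s - 1 \<notin> set l" "b = (s, s + part_at l s)"
    by (auto simp: corner_rows_def)
  let ?c = "part_at l s"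
  have c: "?c \<in> set l" "0 < ?c" using bij_betw_imp_surj_on[OF bij_part_at[OF assms]] s part_at_pos[OF assms] by auto
  obtain k where k: "strict_part k" "?c - 1 \<in> insert 0 (set k)" "?c \<notin> set k" "grow (?c - 1) k = l"
    using strict_part_shrink[OF assms c(1) s(3)] by blast
  obtain r where r: "r < length l" "l ! r = ?c - 1 + 1" "(r + 1, r + (?c - 1) + 2) \<notin> diagram k"
    "diagram l = insert (r + 1, r + (?c - 1) + 2) (diagram k)"
    using diagram_grow[OF k(1,2)] unfolding k(4) by blast
  have "part_at l (r + 1) = part_at l s" using r(1,2) c by (simp add: part_at_def)
  then have "r + 1 = s"
    using inj_onD[OF bij_betw_imp_inj_on[OF bij_part_at[OF assms]], of "r + 1" s] r(1) s by auto
  then have "b = (r + 1, r + (?c - 1) + 2)" using s c by simp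
  then show "b \<in> outer_corners l" using r(3,4) k(1) by (auto simp: outer_corners_def)
qed

lemma corner_list_eq:
  assumes "strict_part l"
  shows "corner_list l = map (\<lambda>r. (r, r + part_at l r)) (rev (sorted_list_of_set (corner_rows l)))"
proof -
  let ?f = "\<lambda>r. (r, r + part_at l r)"
  have fin: "finite (corner_rows l)" by (rule finite_subset[of _ "{..length l}"]) (auto simp: corner_rows_def)
  have "sorted_list_of_set (outer_corners l) = map ?f (sorted_list_of_set (corner_rows l))"
  proof (rule sorted_distinct_set_unique)
    show "sorted (map ?f (sorted_list_of_set (corner_rows l)))"
      unfolding sorted_map by (rule sorted_wrt_mono_rel[of _ "(<)"])
        (auto simp: less_eq_prod_def)
    show "distinct (map ?f (sorted_list_of_set (corner_rows l)))"
      by (auto simp: distinct_map inj_on_def)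
    show "set (sorted_list_of_set (outer_corners l)) = set (map ?f (sorted_list_of_set (corner_rows l)))"
      using fin outer_corners_eq[OF assms] by simp
  qed auto
  then show ?thesis by (simp add: corner_list_def rev_map)
qed

text \<open>The part that blocks the lowering of row \<open>s\<close> stands below it. Since parts
  drop by at least one per row, it can only stand in the next row.\<close>

lemma part_at_pred_not_corner:
  assumes "strict_part l" "1 \<le> s" "s < length l" "s \<notin> corner_rows l"
  shows "part_at l s = part_at l (s + 1) + 1"
proof -
  have "part_at l s - 1 \<in> set l" using assms by (auto simp: corner_rows_def)
  then obtain t where t: "1 \<le> t" "t \<le> length l" "part_at l t = part_at l s - 1"
    using bij_betw_imp_surj_on[OF bij_part_at[OF assms(1)], symmetric] by auto
  have "s + 1 + part_at l (s + 1) \<le> s + part_at l s"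
    using assms by (intro part_at_shift_mono) auto
  moreover have "s < t"
    using part_at_shift_mono[OF assms(1), of t s] part_at_pos[OF assms(1), of s] t assms by (cases "s < t") auto
  then have "t + part_at l t \<le> s + 1 + part_at l (s + 1)"
    using t by (intro part_at_shift_mono[OF assms(1)]) auto
  ultimately show ?thesis using t \<open>s < t\<close> by linarith
qed

text \<open>Going up from a row through rows that are not corners, the parts are consecutive
  integers, so the first differences telescope.\<close>

lemma sum_between_corners:
  fixes f :: "nat \<Rightarrow> real"
  assumes "strict_part l" "r \<le> length l" "d < r" "\<forall>s. r - d \<le> s \<and> s < r \<longrightarrow> s \<notin> corner_rows l"
  shows "part_at l (r - d) = part_at l r + d \<and>
    (\<Sum>s\<in>{r - d..r}. f (part_at l s + 1) - f (part_at l s)) = f (part_at l r + d + 1) - f (part_at l r)"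
  using assms(3,4)
proof (induction d)
  case (Suc d)
  let ?s = "r - Suc d"
  have s: "r - d = ?s + 1" using Suc.prems by simp
  have IH: "part_at l (r - d) = part_at l r + d"
    "(\<Sum>s\<in>{r - d..r}. f (part_at l s + 1) - f (part_at l s)) = f (part_at l r + d + 1) - f (part_at l r)"
  proof -
    have "\<forall>s. r - d \<le> s \<and> s < r \<longrightarrow> s \<notin> corner_rows l"
    proof (intro allI impI)
      fix s assume "r - d \<le> s \<and> s < r"
      then have "r - Suc d \<le> s \<and> s < r" by auto
      then show "s \<notin> corner_rows l" using Suc.prems(2) by blast
    qed
    then show "part_at l (r - d) = part_at l r + d"
      "(\<Sum>s\<in>{r - d..r}. f (part_at l s + 1) - f (part_at l s)) = f (part_at l r + d + 1) - f (part_at l r)"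
      using Suc.IH Suc.prems(1) by auto
  qed
  have "part_at l ?s = part_at l (?s + 1) + 1"
    using Suc.prems assms by (intro part_at_pred_not_corner) auto
  then have p: "part_at l ?s = part_at l r + Suc d" using IH(1) s by simp
  have "{?s..r} = insert ?s {r - d..r}" using Suc.prems by auto
  then have "(\<Sum>s\<in>{?s..r}. f (part_at l s + 1) - f (part_at l s)) =
    f (part_at l ?s + 1) - f (part_at l ?s) + (f (part_at l r + d + 1) - f (part_at l r))"
    unfolding IH(2)[symmetric] using Suc.prems by (simp only: sum.insert finite_atLeastAtMost) auto
  then show ?case using p by simp
qed auto

text \<open>The parts fall into maximal runs of consecutive integers, one for each corner. The run
  of corner \<open>i\<close> goes from \<open>y_i\<close> to \<open>x_i - 1\<close>, so its first
  differences add up to the \<open>i\<close>-th pair of terms of \<open>qk\<close>. The remaining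
  term belongs to \<open>x_0 = 1\<close> and vanishes because \<open>k \<ge> 1\<close>; at
  \<open>k = 0\<close> the left side would be 1 and the right side 0.\<close>

lemma qk_eq:
  assumes l: "strict_part l" and k: "1 \<le> k"
  shows "qk l k = (\<Sum>a\<in>set l. binom2 (int a + 1) ^ k - binom2 (int a) ^ k)"
proof -
  define f where "f = (\<lambda>a. binom2 (int a) ^ k)"
  define rs where "rs = rev (sorted_list_of_set (corner_rows l))"
  define m where "m = length rs"
  define \<alpha> where "\<alpha> = (\<lambda>i. if 1 \<le> i \<and> i \<le> m then rs ! (i - 1) else 0)"
  define G where "G = (\<lambda>r. \<Sum>s=1..r. f (part_at l s + 1) - f (part_at l s))"
  have fin: "finite (corner_rows l)" by (rule finite_subset[of _ "{..length l}"]) (auto simp: corner_rows_def)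
  have cl: "corner_list l = map (\<lambda>r. (r, r + part_at l r)) rs"
    using corner_list_eq[OF l] by (simp add: rs_def)
  have set_rs: "set rs = corner_rows l" using fin by (simp add: rs_def)
  have dec: "sorted_wrt (>) rs" by (simp add: rs_def sorted_wrt_rev)
  have ca: "c_alpha l i = int (\<alpha> i)" for i
    by (auto simp: c_alpha_def \<alpha>_def m_def cl)
  have cb: "c_beta l i = int (\<alpha> i + part_at l (\<alpha> i))" if "1 \<le> i" "i \<le> m" for i
    using that by (auto simp: c_beta_def \<alpha>_def m_def cl)
  have cb0: "c_beta l 0 = int (length l) + 1" by (simp add: c_beta_def)
  have \<alpha>_in: "\<alpha> i \<in> corner_rows l" if "1 \<le> i" "i \<le> m" for i
    using that set_rs nth_mem[of "i - 1" rs] by (auto simp: \<alpha>_def m_def)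
  have \<alpha>_dec: "\<alpha> (i + 1) < \<alpha> i" if "1 \<le> i" "i \<le> m" for i
  proof (cases "i = m")
    case True
    then show ?thesis using \<alpha>_in[OF that] by (auto simp: \<alpha>_def corner_rows_def)
  next
    case False
    then show ?thesis using that sorted_wrt_nth_less[OF dec, of "i - 1" i] by (auto simp: \<alpha>_def m_def)
  qed
  have gap: "s \<notin> corner_rows l" if "1 \<le> i" "i \<le> m" "\<alpha> (i + 1) < s" "s < \<alpha> i" for i s
  proof
    assume "s \<in> corner_rows l"
    then obtain j where j: "j < m" "s = rs ! j" using set_rs by (metis in_set_conv_nth m_def)
    have "j < i - 1 \<Longrightarrow> rs ! (i - 1) < s" "i < m \<Longrightarrow> i < j \<Longrightarrow> s < rs ! i"
      using sorted_wrt_nth_less[OF dec, of j "i - 1"] sorted_wrt_nth_less[OF dec, of i j] j that by (auto simp: m_def)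
    moreover have "s < rs ! (i - 1)" "i < m \<Longrightarrow> rs ! i < s" using that by (auto simp: \<alpha>_def)
    ultimately have "\<not> j < i - 1" "j \<noteq> i - 1" "\<not> (i < m \<and> i < j)" "\<not> (i < m \<and> j = i)" using j by auto
    then show False using j(1) that(1,2) by linarith
  qed
  have step: "binom2 (c_beta l i - c_alpha l (i + 1)) ^ k - binom2 (c_beta l i - c_alpha l i) ^ k = G (\<alpha> i) - G (\<alpha> (i + 1))"
    if i: "1 \<le> i" "i \<le> m" for i
  proof -
    \<comment> \<open>The run of corner \<open>i\<close> occupies \<open>?d + 1\<close>
      rows.\<close>
    let ?d = "\<alpha> i - \<alpha> (i + 1) - 1"
    have d: "\<alpha> i - ?d = \<alpha> (i + 1) + 1" "?d < \<alpha> i" using \<alpha>_dec[OF i] by auto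
    have "(\<Sum>s\<in>{\<alpha> i - ?d..\<alpha> i}. f (part_at l s + 1) - f (part_at l s)) = f (part_at l (\<alpha> i) + ?d + 1) - f (part_at l (\<alpha> i))"
      using \<alpha>_in[OF i] gap[OF i] d by (intro sum_between_corners[OF l, THEN conjunct2]) (auto simp: corner_rows_def)
    moreover have "G (\<alpha> i) = G (\<alpha> (i + 1)) + (\<Sum>s\<in>{\<alpha> i - ?d..\<alpha> i}. f (part_at l s + 1) - f (part_at l s))"
      unfolding G_def d(1) using \<alpha>_dec[OF i] sum.ub_add_nat[of 1 "\<alpha> (i + 1)" _ "\<alpha> i - \<alpha> (i + 1)"] by simp
    moreover have "binom2 (c_beta l i - c_alpha l (i + 1)) ^ k = f (part_at l (\<alpha> i) + ?d + 1)"
      using \<alpha>_dec[OF i] unfolding f_def cb[OF i] ca by (intro arg_cong[where f = "\<lambda>x. binom2 x ^ k"]) linarith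
    moreover have "binom2 (c_beta l i - c_alpha l i) ^ k = f (part_at l (\<alpha> i))"
      unfolding f_def cb[OF i] ca by simp
    ultimately show ?thesis by simp
  qed
  have G_len: "G (length l) = (\<Sum>a\<in>set l. binom2 (int a + 1) ^ k - binom2 (int a) ^ k)"
    using sum.reindex_bij_betw[OF bij_part_at[OF l], of "\<lambda>a. f (a + 1) - f a"]
    by (simp add: G_def f_def add.commute)
  \<comment> \<open>Nothing blocks the smallest part, so the last row is always a corner; for the
    empty partition both sides are 0. This gives \<open>x_0 = 1\<close>.\<close>
  have \<alpha>1: "\<alpha> 1 = length l"
  proof (cases "l = []")
    case True
    then have "corner_rows l = {}" by (auto simp: corner_rows_def)
    then show ?thesis using True by (simp add: \<alpha>_def m_def rs_def)
  next
    case False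
    have "part_at l (length l) - 1 \<notin> set l"
    proof
      assume "part_at l (length l) - 1 \<in> set l"
      then obtain t where t: "1 \<le> t" "t \<le> length l" "part_at l t = part_at l (length l) - 1"
        using bij_betw_imp_surj_on[OF bij_part_at[OF l], symmetric] by auto
      have "length l + part_at l (length l) \<le> t + part_at l t"
        using t by (intro part_at_shift_mono[OF l]) auto
      moreover have "0 < part_at l (length l)" using False by (intro part_at_pos[OF l]) (auto simp: Suc_le_eq)
      ultimately show False using t(2,3) by linarith
    qed
    then have "length l \<in> set rs" unfolding set_rs using False by (simp add: corner_rows_def Suc_le_eq)
    then obtain j where j: "j < m" "rs ! j = length l" unfolding m_def in_set_conv_nth by blast
    have "rs ! 0 \<in> corner_rows l" unfolding set_rs[symmetric] using j(1) by (intro nth_mem) (auto simp: m_def)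
    then have "rs ! 0 \<le> length l" by (simp add: corner_rows_def)
    moreover have "rs ! j < rs ! 0" if "0 < j"
      using sorted_wrt_nth_less[OF dec, of 0 j] that j(1) by (simp add: m_def)
    ultimately have "\<not> 0 < j" using j(2) by linarith
    then show ?thesis using j by (simp add: \<alpha>_def Suc_le_eq)
  qed
  have "qk l k = binom2 (c_beta l 0 - c_alpha l 1) ^ k +
    (\<Sum>i=1..m. binom2 (c_beta l i - c_alpha l (i + 1)) ^ k - binom2 (c_beta l i - c_alpha l i) ^ k)"
  proof -
    have "(\<Sum>i=0..m. binom2 (c_beta l i - c_alpha l (i + 1)) ^ k) =
      binom2 (c_beta l 0 - c_alpha l 1) ^ k + (\<Sum>i=1..m. binom2 (c_beta l i - c_alpha l (i + 1)) ^ k)"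
      by (subst sum.atLeast_Suc_atMost) auto
    then show ?thesis
      unfolding qk_def Let_def cl length_map m_def[symmetric] sum_subtractf by simp
  qed
  also have "binom2 (c_beta l 0 - c_alpha l 1) ^ k = 0"
    unfolding cb0 ca \<alpha>1 using k by (simp add: binom2_def)
  also have "(\<Sum>i=1..m. binom2 (c_beta l i - c_alpha l (i + 1)) ^ k - binom2 (c_beta l i - c_alpha l i) ^ k) =
    (\<Sum>i=1..m. G (\<alpha> i) - G (\<alpha> (i + 1)))"
    using step by (intro sum.cong) auto
  also have "\<dots> = (\<Sum>i<m. G (\<alpha> (Suc i)) - G (\<alpha> (Suc (Suc i))))"
    by (simp add: sum.atLeast1_atMost_eq)
  also have "\<dots> = G (\<alpha> 1) - G (\<alpha> (m + 1))"
    using sum_lessThan_telescope'[of "\<lambda>i. G (\<alpha> (Suc i))" m] by simp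
  also have "\<dots> = G (length l)" unfolding \<alpha>1 by (simp add: \<alpha>_def G_def)
  finally show ?thesis using G_len by simp
qed

section \<open>Partial fractions and moments of the growth weights\<close>

lemma degree_prod_monic_linear:
  "finite A \<Longrightarrow> degree (\<Prod>a\<in>A. [:- f a, 1:: 'a :: idom:]) = card A"
  by (subst degree_prod_eq_sum_degree) auto

text \<open>Both sides have degree below \<open>card I\<close> and agree at \<open>card I\<close>
  points.\<close>

lemma lagrange_interpolation:
  fixes z :: "'i \<Rightarrow> 'a :: field"
  assumes "finite I" "inj_on z I" "degree P < card I"
  shows "P = (\<Sum>i\<in>I. smult (poly P (z i) / (\<Prod>j\<in>I - {i}. z i - z j)) (\<Prod>j\<in>I - {i}. [:- z j, 1:]))"
    (is "P = ?R")
proof (rule poly_eqI_degree[of "z ` I"])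
  fix x assume "x \<in> z ` I"
  then obtain k where k: "k \<in> I" "x = z k" by auto
  have "poly ?R x = (\<Sum>i\<in>I. if i = k then poly P (z k) else 0)"
    unfolding poly_sum
  proof (rule sum.cong)
    fix i assume i: "i \<in> I"
    show "poly (smult (poly P (z i) / (\<Prod>j\<in>I - {i}. z i - z j)) (\<Prod>j\<in>I - {i}. [:- z j, 1:])) x =
      (if i = k then poly P (z k) else 0)"
    proof (cases "i = k")
      case True
      have "(\<Prod>j\<in>I - {k}. z k - z j) \<noteq> 0"
        using assms k by (auto simp: inj_on_def)
      then show ?thesis using True k by (simp add: poly_prod)
    next
      case False
      then show ?thesis using assms k by (auto simp: poly_prod)
    qed
  qed auto
  then show "poly P x = poly ?R x" using assms k by simp
next
  show "card (z ` I) > degree P" using assms by (simp add: card_image)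
  have "degree (smult (c i) (\<Prod>j\<in>I - {i}. [:- z j, 1:])) \<le> card I - 1" if "i \<in> I" for c i
    using degree_prod_monic_linear[of "I - {i}" z] assms that
    by (intro order.trans[OF degree_smult_le]) auto
  then have "degree ?R \<le> card I - 1" using assms(1) by (intro degree_sum_le)
  then show "card (z ` I) > degree ?R" using assms by (simp add: card_image)
qed

text \<open>Passage from \<open>t\<close> to \<open>s = 1 / t\<close>: interpolation takes place in
  \<open>t\<close>, while the moments are coefficients of an expansion in powers of
  \<open>1 / t\<close>.\<close>

lemma poly_prod_reverse:
  fixes f :: "'i \<Rightarrow> 'a :: field"
  assumes "s \<noteq> 0"
  shows "s ^ card A * poly (\<Prod>a\<in>A. [:- f a, 1:]) (1 / s) = (\<Prod>a\<in>A. 1 - f a * s)"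
proof -
  have "s ^ card A * (\<Prod>a\<in>A. 1 / s - f a) = (\<Prod>a\<in>A. s * (1 / s - f a))"
    by (simp add: prod.distrib)
  also have "\<dots> = (\<Prod>a\<in>A. 1 - f a * s)"
    using assms by (intro prod.cong) (auto simp: field_simps)
  finally show ?thesis by (simp add: poly_prod)
qed

section \<open>Generating functions and Newton's identity\<close>

definition fps_geom :: "'a :: field \<Rightarrow> 'a fps" where
  "fps_geom z = Abs_fps (\<lambda>n. z ^ n)"

lemma fps_geom_inverse: "fps_geom z * (1 - fps_const z * fps_X) = 1"
proof (rule fps_ext)
  fix n
  have "fps_geom z * (1 - fps_const z * fps_X) = fps_geom z - fps_const z * (fps_X * fps_geom z)"
    by (simp add: right_diff_distrib mult.left_commute mult.commute)
  then show "fps_nth (fps_geom z * (1 - fps_const z * fps_X)) n = fps_nth 1 n"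
    by (cases n) (simp_all add: fps_geom_def)
qed

text \<open>The polynomial with zeros \<open>u b\<close> is interpolated at the poles
  \<open>z i\<close>, divided by the product over the poles and rewritten in \<open>1 / t\<close>.
  Having one more pole than zeros keeps its degree below \<open>card I\<close>.\<close>

lemma fps_partial_fractions:
  fixes u z :: "'i \<Rightarrow> real"
  assumes "finite I" "finite S" "inj_on z I" "card I = Suc (card S)"
  shows "(\<Prod>b\<in>S. 1 - fps_const (u b) * fps_X) * (\<Prod>i\<in>I. fps_geom (z i)) =
    (\<Sum>i\<in>I. fps_const ((\<Prod>b\<in>S. z i - u b) / (\<Prod>j\<in>I - {i}. z i - z j)) * fps_geom (z i))"
proof -
  let ?w = "\<lambda>i. (\<Prod>b\<in>S. z i - u b) / (\<Prod>j\<in>I - {i}. z i - z j)"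
  let ?P = "\<Prod>b\<in>S. [:- u b, 1:]"
  let ?L = "\<Prod>b\<in>S. [:1, - u b:]" and ?R = "\<Sum>i\<in>I. smult (?w i) (\<Prod>j\<in>I - {i}. [:1, - z j:])"
  have "degree ?P < card I" using assms by (simp add: degree_prod_monic_linear)
  from lagrange_interpolation[OF assms(1,3) this]
  have P: "?P = (\<Sum>i\<in>I. smult (?w i) (\<Prod>j\<in>I - {i}. [:- z j, 1:]))"
    by (simp add: poly_prod)
  have "poly ?L s = poly ?R s" if "s \<noteq> 0" for s
  proof -
    have "poly ?L s = s ^ card S * poly ?P (1 / s)"
      using poly_prod_reverse[OF that, of S u] by (simp add: poly_prod mult.commute)
    also have "\<dots> = (\<Sum>i\<in>I. ?w i * (s ^ card S * poly (\<Prod>j\<in>I - {i}. [:- z j, 1:]) (1 / s)))"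
      by (subst P) (simp add: poly_sum sum_distrib_left mult_ac)
    also have "\<dots> = (\<Sum>i\<in>I. ?w i * (\<Prod>j\<in>I - {i}. 1 - z j * s))"
    proof (intro sum.cong refl)
      fix i assume "i \<in> I"
      then have "card S = card (I - {i})" using assms by simp
      then show "?w i * (s ^ card S * poly (\<Prod>j\<in>I - {i}. [:- z j, 1:]) (1 / s)) = ?w i * (\<Prod>j\<in>I - {i}. 1 - z j * s)"
        using poly_prod_reverse[OF that, of "I - {i}" z] by simp
    qed
    also have "\<dots> = poly ?R s" by (simp add: poly_sum poly_prod mult.commute)
    finally show ?thesis .
  qed
  \<comment> \<open>The substitution \<open>s = 1 / t\<close> misses \<open>s = 0\<close>. A factor
    \<open>X\<close> makes the values there agree trivially and is cancelled afterwards.\<close>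
  then have "poly ([:0, 1:] * ?L) s = poly ([:0, 1:] * ?R) s" for s
    by (cases "s = 0") auto
  then have "[:0, 1:] * ?L = [:0, 1:] * ?R" by (intro iffD1[OF poly_eq_poly_eq_iff] ext)
  then have "?L = ?R" by (subst (asm) mult_cancel_left) auto
  then have "fps_of_poly ?L = fps_of_poly ?R" by simp
  then have LR: "(\<Prod>b\<in>S. 1 - fps_const (u b) * fps_X) = (\<Sum>i\<in>I. fps_const (?w i) * (\<Prod>j\<in>I - {i}. 1 - fps_const (z j) * fps_X))"
    by (simp add: fps_of_poly_prod fps_of_poly_sum fps_of_poly_smult fps_of_poly_pCons fps_const_neg[symmetric] del: fps_const_neg)
  have "(\<Prod>j\<in>I - {i}. 1 - fps_const (z j) * fps_X) * (\<Prod>i\<in>I. fps_geom (z i)) = fps_geom (z i)" if "i \<in> I" for i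
  proof -
    have "(\<Prod>i\<in>I. fps_geom (z i)) = fps_geom (z i) * (\<Prod>i\<in>I - {i}. fps_geom (z i))"
      using assms that by (simp add: prod.remove)
    moreover have "(\<Prod>j\<in>I - {i}. 1 - fps_const (z j) * fps_X) * (\<Prod>i\<in>I - {i}. fps_geom (z i)) = 1"
      unfolding prod.distrib[symmetric] by (intro prod.neutral ballI trans[OF mult.commute fps_geom_inverse])
    ultimately show ?thesis by (simp add: mult_ac)
  qed
  then show ?thesis unfolding LR by (simp add: sum_distrib_right mult.assoc)
qed

text \<open>\<open>g a\<close> is \<open>X\<close> times the logarithmic derivative of
  \<open>f a\<close>, stated without division; logarithmic derivatives of a product add up.\<close>

lemma fps_log_deriv_prod:
  fixes f g :: "'i \<Rightarrow> real fps"
  assumes "finite A" "\<And>a. a \<in> A \<Longrightarrow> fps_X * fps_deriv (f a) = f a * g a"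
  shows "fps_X * fps_deriv (\<Prod>a\<in>A. f a) = (\<Prod>a\<in>A. f a) * (\<Sum>a\<in>A. g a)"
  using assms
proof (induction rule: finite_induct)
  case (insert a A)
  have "fps_X * fps_deriv (f a * (\<Prod>a\<in>A. f a)) =
     f a * (fps_X * fps_deriv (\<Prod>a\<in>A. f a)) + (fps_X * fps_deriv (f a)) * (\<Prod>a\<in>A. f a)"
    by (simp add: algebra_simps)
  then show ?case using insert by (simp add: algebra_simps)
qed auto

lemma fps_log_deriv_linear:
  fixes c :: real
  shows "fps_X * fps_deriv (1 - fps_const c * fps_X) = (1 - fps_const c * fps_X) * (1 - fps_geom c)"
proof -
  have "(1 - fps_const c * fps_X) * (1 - fps_geom c) = (1 - fps_const c * fps_X) - fps_geom c * (1 - fps_const c * fps_X)"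
    by (simp add: algebra_simps)
  then show ?thesis by (simp add: fps_geom_inverse)
qed

lemma fps_log_deriv_geom:
  fixes c :: real
  shows "fps_X * fps_deriv (fps_geom c) = fps_geom c * (fps_geom c - 1)"
proof (rule fps_ext)
  fix n
  have "fps_nth (fps_geom c * fps_geom c) n = real (n + 1) * c ^ n"
    by (simp add: fps_mult_nth fps_geom_def power_add[symmetric])
  then show "fps_nth (fps_X * fps_deriv (fps_geom c)) n = fps_nth (fps_geom c * (fps_geom c - 1)) n"
    by (cases n) (simp_all add: fps_geom_def right_diff_distrib algebra_simps)
qed

text \<open>In product form the series \<open>E\<close> has a logarithmic derivative whose
  coefficients are the differences of power sums; in partial fraction form its own coefficients are
  the \<open>W k\<close>. Comparing coefficients in \<open>X E' = E L\<close> gives the recursion.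
  The ones in \<open>?L\<close> cancel the constant terms, so \<open>j\<close> starts at 1.\<close>

lemma newton_partial_fractions:
  fixes u z :: "'i \<Rightarrow> real"
  assumes "finite I" "finite S" "inj_on z I" "card I = Suc (card S)"
  defines "W \<equiv> \<lambda>k. \<Sum>i\<in>I. (\<Prod>b\<in>S. z i - u b) / (\<Prod>j\<in>I - {i}. z i - z j) * z i ^ k"
  shows "W 0 = 1"
    and "real k * W k = (\<Sum>j=1..k. ((\<Sum>i\<in>I. z i ^ j) - (\<Sum>b\<in>S. u b ^ j)) * W (k - j))"
proof -
  let ?E = "(\<Prod>b\<in>S. 1 - fps_const (u b) * fps_X) * (\<Prod>i\<in>I. fps_geom (z i))"
  let ?L = "(\<Sum>b\<in>S. 1 - fps_geom (u b)) + (\<Sum>i\<in>I. fps_geom (z i) - 1)"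
  have W: "fps_nth ?E n = W n" for n
    unfolding fps_partial_fractions[OF assms(1-4)] W_def by (simp add: fps_sum_nth fps_geom_def)
  have "fps_nth (\<Prod>a\<in>A. f a) 0 = (\<Prod>a\<in>A. fps_nth (f a) 0)" for A :: "'i set" and f :: "'i \<Rightarrow> real fps"
    by (induction A rule: infinite_finite_induct) simp_all
  then have "fps_nth ?E 0 = 1" by (simp add: fps_geom_def)
  then show "W 0 = 1" unfolding W .
  have nthL: "fps_nth ?L j = (if j = 0 then 0 else (\<Sum>i\<in>I. z i ^ j) - (\<Sum>b\<in>S. u b ^ j))" for j
    by (simp add: fps_sum_nth fps_geom_def sum_subtractf sum_negf)
  have "fps_X * fps_deriv ?E = ?E * ?L"
  proof -
    let ?A = "\<Prod>b\<in>S. 1 - fps_const (u b) * fps_X" and ?B = "\<Prod>i\<in>I. fps_geom (z i)"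
    have "fps_X * fps_deriv (?A * ?B) = ?A * (fps_X * fps_deriv ?B) + (fps_X * fps_deriv ?A) * ?B"
      by (simp add: algebra_simps)
    then show ?thesis
      using fps_log_deriv_prod[OF assms(2) fps_log_deriv_linear, of u] fps_log_deriv_prod[OF assms(1) fps_log_deriv_geom, of z]
      by (simp only:) (simp only: algebra_simps)
  qed
  then have "fps_nth (fps_X * fps_deriv ?E) k = fps_nth (?L * ?E) k" by (simp only: mult.commute)
  moreover have "fps_nth (fps_X * fps_deriv ?E) k = real k * W k"
    unfolding W[symmetric] by (cases k) (simp_all del: fps_deriv_mult)
  moreover have "fps_nth (?L * ?E) k = (\<Sum>j=0..k. fps_nth ?L j * W (k - j))"
    unfolding W[symmetric] by (rule fps_mult_nth)
  moreover have "\<dots> = (\<Sum>j=1..k. ((\<Sum>i\<in>I. z i ^ j) - (\<Sum>b\<in>S. u b ^ j)) * W (k - j))"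
    unfolding nthL by (intro sum.mono_neutral_cong_right) auto
  ultimately show "real k * W k = (\<Sum>j=1..k. ((\<Sum>i\<in>I. z i ^ j) - (\<Sum>b\<in>S. u b ^ j)) * W (k - j))"
    by simp
qed

definition growth_moment :: "nat set \<Rightarrow> nat \<Rightarrow> real" where
  "growth_moment S k = (\<Sum>i\<in>insert 0 S. growth_weight S i * binom2 (int i + 1) ^ k)"

lemma growth_moment:
  assumes "finite S" "0 \<notin> S"
  shows growth_moment_0: "growth_moment S 0 = 1"
    and growth_moment_newton: "real k * growth_moment S k =
      (\<Sum>j=1..k. (\<Sum>b\<in>S. binom2 (int b + 1) ^ j - binom2 (int b) ^ j) * growth_moment S (k - j))"
proof -
  let ?z = "\<lambda>i. binom2 (int i + 1)" and ?u = "\<lambda>b. binom2 (int b)"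
  have "inj_on ?z (insert 0 S)"
  proof (rule inj_onI)
    fix x y assume "?z x = ?z y"
    then have "(real x - real y) * (real x + real y + 1) = 0"
      by (simp add: binom2_def algebra_simps)
    then show "x = y" by (simp add: add_nonneg_eq_0_iff)
  qed
  moreover have "card (insert 0 S) = Suc (card S)" using assms by simp
  ultimately have *: "growth_moment S 0 = 1" "real k * growth_moment S k =
    (\<Sum>j=1..k. ((\<Sum>i\<in>insert 0 S. ?z i ^ j) - (\<Sum>b\<in>S. ?u b ^ j)) * growth_moment S (k - j))"
    using newton_partial_fractions[where I = "insert 0 S" and S = S and z = ?z and u = ?u] assms(1) unfolding growth_moment_def growth_weight_def by blast+
  show "growth_moment S 0 = 1" by fact
  \<comment> \<open>The index 0 contributes the pole \<open>binom2 1 = 0\<close>, which adds nothing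
    to power sums of exponent \<open>j \<ge> 1\<close>.\<close>
  have "(\<Sum>i\<in>insert 0 S. ?z i ^ j) = (\<Sum>i\<in>S. ?z i ^ j)" if "j \<in> {1..k}" for j
    using assms that by (simp add: binom2_def)
  then show "real k * growth_moment S k =
      (\<Sum>j=1..k. (\<Sum>b\<in>S. binom2 (int b + 1) ^ j - binom2 (int b) ^ j) * growth_moment S (k - j))"
    unfolding *(2) by (intro sum.cong) (simp_all add: sum_subtractf)
qed

section \<open>The degree filtration\<close>

lemma finite_exponents:
  assumes "finite B"
  shows "finite {e :: 'b \<Rightarrow> nat. (\<forall>x. x \<notin> B \<longrightarrow> e x = 0) \<and>
    filter_mset (\<lambda>k. k \<noteq> 0) (image_mset e (mset_set B)) = mset \<alpha>}" (is "finite ?E")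
proof (rule finite_subset)
  show "?E \<subseteq> {e. \<forall>x. (x \<in> B \<longrightarrow> e x \<in> insert 0 (set \<alpha>)) \<and> (x \<notin> B \<longrightarrow> e x = 0)}"
  proof (intro subsetI CollectI allI conjI impI)
    fix e x assume e: "e \<in> ?E" and x: "x \<in> B"
    have eq: "filter_mset (\<lambda>k. k \<noteq> 0) (image_mset e (mset_set B)) = mset \<alpha>" using e by blast
    have "e x \<in># image_mset e (mset_set B)" using x assms by simp
    then have "e x = 0 \<or> e x \<in># mset \<alpha>" unfolding eq[symmetric] by auto
    then show "e x \<in> insert 0 (set \<alpha>)" by simp
  qed auto
  show "finite {e. \<forall>x. (x \<in> B \<longrightarrow> e x \<in> insert 0 (set \<alpha>)) \<and> (x \<notin> B \<longrightarrow> e x = 0)}"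
    using assms by (intro finite_set_of_finite_funs) auto
qed

text \<open>The exponent at \<open>b\<close> is 0 or a part \<open>a\<close> of
  \<open>\<alpha>\<close>, and in the latter case the other exponents realise
  \<open>\<alpha>\<close> without one copy of \<open>a\<close>. Equal parts produce the same
  exponent vectors, hence a sum over \<open>set \<alpha>\<close> and not over positions.\<close>

lemma mono_sym_eval_insert:
  assumes B: "finite B" "b \<notin> B" and \<alpha>: "0 \<notin> set \<alpha>"
  shows "mono_sym_eval \<alpha> (insert b B) v =
    mono_sym_eval \<alpha> B v + (\<Sum>a\<in>set \<alpha>. v b ^ a * mono_sym_eval (remove1 a \<alpha>) B v)"
proof -
  define E where "E = (\<lambda>\<alpha> B. {e :: 'a \<Rightarrow> nat. (\<forall>x. x \<notin> B \<longrightarrow> e x = 0) \<and>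
    filter_mset (\<lambda>k. k \<noteq> 0) (image_mset e (mset_set B)) = mset \<alpha>})"
  have fin: "finite (E \<alpha> B)" for \<alpha> unfolding E_def using finite_exponents[OF B(1)] .
  have ev: "mono_sym_eval \<alpha> C v = (\<Sum>e\<in>E \<alpha> C. \<Prod>x\<in>C. v x ^ e x)" for \<alpha> C
    by (simp add: mono_sym_eval_def E_def)
  have b0: "e b = 0" if "e \<in> E \<beta> B" for e \<beta> using that B by (auto simp: E_def)
  have im: "image_mset (e(b := c)) (mset_set B) = image_mset e (mset_set B)" for e :: "'a \<Rightarrow> nat" and c
    using B by (intro image_mset_cong) auto
  have split: "E \<alpha> (insert b B) = E \<alpha> B \<union> (\<Union>a\<in>set \<alpha>. (\<lambda>e. e(b := a)) ` E (remove1 a \<alpha>) B)"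
  proof (intro equalityI subsetI)
    fix e assume e: "e \<in> E \<alpha> (insert b B)"
    show "e \<in> E \<alpha> B \<union> (\<Union>a\<in>set \<alpha>. (\<lambda>e. e(b := a)) ` E (remove1 a \<alpha>) B)"
    proof (cases "e b = 0")
      case True
      have "e x = 0" if "x \<notin> B" for x
        using that True e by (cases "x = b") (auto simp: E_def)
      then have "e \<in> E \<alpha> B" using True e B by (simp add: E_def)
      then show ?thesis by blast
    next
      case False
      then have m: "add_mset (e b) (filter_mset (\<lambda>k. k \<noteq> 0) (image_mset e (mset_set B))) = mset \<alpha>"
        using e B by (auto simp: E_def)
      then have "e b \<in> set \<alpha>" by (metis set_mset_mset union_single_eq_member)
      moreover have "e(b := 0) \<in> E (remove1 (e b) \<alpha>) B"
        using e B m[symmetric] by (auto simp: E_def im)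
      moreover have "e = (e(b := 0))(b := e b)" by simp
      ultimately show ?thesis by blast
    qed
  next
    fix e assume "e \<in> E \<alpha> B \<union> (\<Union>a\<in>set \<alpha>. (\<lambda>e. e(b := a)) ` E (remove1 a \<alpha>) B)"
    then consider "e \<in> E \<alpha> B" | a e' where "a \<in> set \<alpha>" "e' \<in> E (remove1 a \<alpha>) B" "e = e'(b := a)" by blast
    then show "e \<in> E \<alpha> (insert b B)"
    proof cases
      case 1
      then show ?thesis using b0[OF 1] B by (auto simp: E_def)
    next
      case 2
      then have "a \<noteq> 0" using \<alpha> by metis
      then show ?thesis using 2 B by (auto simp: E_def im insert_DiffM)
    qed
  qed
  have "mono_sym_eval \<alpha> (insert b B) v = (\<Sum>e\<in>E \<alpha> B. \<Prod>x\<in>insert b B. v x ^ e x) +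
    (\<Sum>e\<in>(\<Union>a\<in>set \<alpha>. (\<lambda>e. e(b := a)) ` E (remove1 a \<alpha>) B). \<Prod>x\<in>insert b B. v x ^ e x)"
    unfolding ev split
  proof (rule sum.union_disjoint)
    show "E \<alpha> B \<inter> (\<Union>a\<in>set \<alpha>. (\<lambda>e. e(b := a)) ` E (remove1 a \<alpha>) B) = {}"
      using \<alpha> b0 by force
  qed (use fin in auto)
  also have "(\<Sum>e\<in>E \<alpha> B. \<Prod>x\<in>insert b B. v x ^ e x) = mono_sym_eval \<alpha> B v"
    unfolding ev
  proof (intro sum.cong refl)
    fix e assume "e \<in> E \<alpha> B"
    then show "(\<Prod>x\<in>insert b B. v x ^ e x) = (\<Prod>x\<in>B. v x ^ e x)" using b0[of e \<alpha>] B by simp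
  qed
  also have "(\<Sum>e\<in>(\<Union>a\<in>set \<alpha>. (\<lambda>e. e(b := a)) ` E (remove1 a \<alpha>) B). \<Prod>x\<in>insert b B. v x ^ e x) =
    (\<Sum>a\<in>set \<alpha>. \<Sum>e\<in>(\<lambda>e. e(b := a)) ` E (remove1 a \<alpha>) B. \<Prod>x\<in>insert b B. v x ^ e x)"
  proof (rule sum.UNION_disjoint)
    show "\<forall>i\<in>set \<alpha>. \<forall>j\<in>set \<alpha>. i \<noteq> j \<longrightarrow>
      (\<lambda>e. e(b := i)) ` E (remove1 i \<alpha>) B \<inter> (\<lambda>e. e(b := j)) ` E (remove1 j \<alpha>) B = {}"
      by (auto simp: fun_eq_iff) (metis fun_upd_same)
  qed (use fin in auto)
  also have "\<dots> = (\<Sum>a\<in>set \<alpha>. v b ^ a * mono_sym_eval (remove1 a \<alpha>) B v)"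
  proof (rule sum.cong)
    fix a assume "a \<in> set \<alpha>"
    have "inj_on (\<lambda>e. e(b := a)) (E (remove1 a \<alpha>) B)"
    proof (rule inj_onI)
      fix e e' assume *: "e \<in> E (remove1 a \<alpha>) B" "e' \<in> E (remove1 a \<alpha>) B" "e(b := a) = e'(b := a)"
      then show "e = e'" by (metis b0 fun_upd_triv fun_upd_upd)
    qed
    moreover have "(\<Prod>x\<in>insert b B. v x ^ (e(b := a)) x) = v b ^ a * (\<Prod>x\<in>B. v x ^ e x)" for e :: "'a \<Rightarrow> nat"
    proof -
      have "(\<Prod>x\<in>B. v x ^ (e(b := a)) x) = (\<Prod>x\<in>B. v x ^ e x)" using B by (intro prod.cong) auto
      then show ?thesis using B by simp
    qed
    ultimately show "(\<Sum>e\<in>(\<lambda>e. e(b := a)) ` E (remove1 a \<alpha>) B. \<Prod>x\<in>insert b B. v x ^ e x) =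
      v b ^ a * mono_sym_eval (remove1 a \<alpha>) B v"
      by (simp only: sum.reindex comp_def ev sum_distrib_left)
  qed auto
  finally show ?thesis .
qed

section \<open>Filtered functions and polynomials over them\<close>

text \<open>\<open>d\<close> bounds the degree of one way to build the function;
  \<open>filt_le\<close> makes this a filtration and not a grading. The generators
  \<open>q_k\<close> start at \<open>k = 1\<close>, where their description by parts is
  valid.\<close>

inductive filt :: "nat \<Rightarrow> (nat list \<Rightarrow> real) \<Rightarrow> bool" where
  filt_const: "filt 0 (\<lambda>_. c)"
| filt_qk: "1 \<le> k \<Longrightarrow> filt k (\<lambda>l. qk l k)"
| filt_mono_sym: "0 \<notin> set \<alpha> \<Longrightarrow> filt (sum_list \<alpha> + length \<alpha>) (\<lambda>l. mono_sym_eval \<alpha> (diagram l) content_binom)"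
| filt_add: "filt d F \<Longrightarrow> filt d G \<Longrightarrow> filt d (\<lambda>l. F l + G l)"
| filt_mult: "filt d F \<Longrightarrow> filt e G \<Longrightarrow> filt (d + e) (\<lambda>l. F l * G l)"
| filt_le: "filt d F \<Longrightarrow> d \<le> e \<Longrightarrow> filt e F"

lemma filt_const': "filt d (\<lambda>_. c)"
  using filt_le[OF filt_const] by blast

lemma filt_cmult: "filt d F \<Longrightarrow> filt d (\<lambda>l. c * F l)"
  using filt_mult[OF filt_const] by fastforce

lemma filt_sum: "(\<And>a. a \<in> A \<Longrightarrow> filt d (F a)) \<Longrightarrow> filt d (\<lambda>l. \<Sum>a\<in>A. F a l)"
  by (induction A rule: infinite_finite_induct) (auto intro: filt_add filt_const')

text \<open>Polynomials in \<open>x\<close>, itself of degree 1, with coefficients in the filtered algebra; \<open>x\<close> will be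
  \<open>binom2\<close> of the content of the added box.\<close>
inductive xfilt :: "nat \<Rightarrow> (nat list \<Rightarrow> real \<Rightarrow> real) \<Rightarrow> bool" where
  xfilt_monom: "filt d F \<Longrightarrow> xfilt (d + j) (\<lambda>l x. F l * x ^ j)"
| xfilt_add: "xfilt d R \<Longrightarrow> xfilt d T \<Longrightarrow> xfilt d (\<lambda>l x. R l x + T l x)"
| xfilt_le: "xfilt d R \<Longrightarrow> d \<le> e \<Longrightarrow> xfilt e R"

lemma xfilt_coeff: "filt d F \<Longrightarrow> xfilt d (\<lambda>l x. F l)"
  using xfilt_monom[of d F 0] by simp

lemma xfilt_0: "xfilt d (\<lambda>l x. 0)"
  using xfilt_coeff[OF filt_const'] by blast

lemma xfilt_power: "xfilt j (\<lambda>l x. x ^ j)"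
  using xfilt_monom[OF filt_const[of 1], of j] by simp

lemma xfilt_mult:
  assumes "xfilt d R" "xfilt e T"
  shows "xfilt (d + e) (\<lambda>l x. R l x * T l x)"
  using assms
proof (induction arbitrary: e T rule: xfilt.induct)
  case (xfilt_monom d F j)
  from xfilt_monom(2) show ?case
  proof (induction rule: xfilt.induct)
    case (xfilt_monom e G i)
    from xfilt.xfilt_monom[OF filt_mult[OF \<open>filt d F\<close> xfilt_monom], of "j + i"]
    show ?case by (simp add: power_add mult_ac add_ac)
  next
    case (xfilt_add e R T)
    from xfilt.xfilt_add[OF xfilt_add(3,4)] show ?case by (simp add: algebra_simps)
  next
    case (xfilt_le e R e')
    from xfilt.xfilt_le[OF xfilt_le(3), of "d + j + e'"] xfilt_le(2) show ?case by simp
  qed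
next
  case (xfilt_add d R T)
  from xfilt.xfilt_add[OF xfilt_add(3,4)[OF xfilt_add(5)]] show ?case by (simp add: algebra_simps)
next
  case (xfilt_le d R d')
  from xfilt.xfilt_le[OF xfilt_le(3)[OF xfilt_le(4)], of "d' + e"] xfilt_le(2) show ?case by simp
qed

lemma xfilt_cmult: "xfilt d R \<Longrightarrow> xfilt d (\<lambda>l x. c * R l x)"
  using xfilt_mult[OF xfilt_coeff[OF filt_const]] by fastforce

lemma xfilt_sum: "(\<And>a. a \<in> A \<Longrightarrow> xfilt d (R a)) \<Longrightarrow> xfilt d (\<lambda>l x. \<Sum>a\<in>A. R a l x)"
  by (induction A rule: infinite_finite_induct) (auto intro: xfilt_add xfilt_0)

section \<open>The change of the generators under an added box\<close>

text \<open>With \<open>U = binom2 (c + 1)\<close>, \<open>V = binom2 (c - 1)\<close> and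
  \<open>X = binom2 c\<close>, the sum \<open>U + V = 2 * X + 1\<close> and the product
  \<open>U * V = X ^ 2 - X\<close> are polynomials in \<open>X\<close>. The two-term recursion for
  power sums then makes \<open>U ^ k + V ^ k\<close> such a polynomial, with leading term
  \<open>2 * X ^ k\<close>. The clause for \<open>k = 0\<close> stands for degree -1, which
  \<open>k - 1\<close> cannot express.\<close>

lemma binom2_second_difference:
  "\<exists>R. (k = 0 \<longrightarrow> R = (\<lambda>_. 0)) \<and> xfilt (k - 1) (\<lambda>_. R) \<and>
    (\<forall>c. binom2 (c + 1) ^ k + binom2 (c - 1) ^ k - 2 * binom2 c ^ k = R (binom2 c))"
proof (induction k rule: induct_nat_012)
  case 0
  show ?case by (intro exI[of _ "\<lambda>_. 0"]) (simp add: xfilt_0)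
next
  case 1
  have "binom2 (c + 1) + binom2 (c - 1) - 2 * binom2 c = 1" for c by (simp add: binom2_def field_simps)
  then show ?case by (intro exI[of _ "\<lambda>_. 1"]) (simp add: xfilt_coeff filt_const)
next
  case (ge2 k)
  then obtain R T where
    R: "k = 0 \<longrightarrow> R = (\<lambda>_. 0)" "xfilt (k - 1) (\<lambda>_. R)"
       "\<And>c. binom2 (c + 1) ^ k + binom2 (c - 1) ^ k - 2 * binom2 c ^ k = R (binom2 c)" and
    T: "xfilt k (\<lambda>_. T)"
       "\<And>c. binom2 (c + 1) ^ Suc k + binom2 (c - 1) ^ Suc k - 2 * binom2 c ^ Suc k = T (binom2 c)"
    by auto
  \<comment> \<open>The recursion with \<open>T + 2 * X ^ (k + 1)\<close> and
    \<open>R + 2 * X ^ k\<close> inserted: the multiples of \<open>X ^ (k + 2)\<close> cancel and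
    \<open>4 * X ^ (k + 1)\<close> remains.\<close>
  let ?Z = "\<lambda>x. (2 * x + 1) * T x + (- 1) * ((x ^ 2 + (- 1) * x) * R x) + 4 * x ^ (k + 1)"
  have x: "xfilt 1 (\<lambda>_ x. x)" using xfilt_power[of 1] by simp
  have "xfilt (1 + k) (\<lambda>_ x. (2 * x + 1) * T x)"
    by (intro xfilt_mult T xfilt_add xfilt_cmult x xfilt_coeff filt_const')
  \<comment> \<open>At \<open>k = 0\<close> the bound \<open>2 + (k - 1)\<close> is one too large,
    and \<open>R = 0\<close> takes its place.\<close>
  moreover have "xfilt (1 + k) (\<lambda>_ x. (- 1) * ((x ^ 2 + (- 1) * x) * R x))"
  proof (cases "k = 0")
    case True
    then show ?thesis using R(1) by (simp add: xfilt_0)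
  next
    case False
    have "xfilt (2 + (k - 1)) (\<lambda>_ x. (x ^ 2 + (- 1) * x) * R x)"
      by (intro xfilt_mult R xfilt_add xfilt_cmult xfilt_power xfilt_le[OF x]) simp
    then show ?thesis using False by (intro xfilt_cmult) simp
  qed
  moreover have "xfilt (1 + k) (\<lambda>_ x. 4 * x ^ (k + 1))"
    using xfilt_cmult[OF xfilt_power[of "k + 1"], where c = 4] by simp
  ultimately have "xfilt (1 + k) (\<lambda>_. ?Z)" by (intro xfilt_add)
  moreover have "binom2 (c + 1) ^ Suc (Suc k) + binom2 (c - 1) ^ Suc (Suc k) - 2 * binom2 c ^ Suc (Suc k) = ?Z (binom2 c)" for c
  proof -
    define X U V where "X = binom2 c" and "U = binom2 (c + 1)" and "V = binom2 (c - 1)"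
    have UV: "U + V = 2 * X + 1" "U * V = X ^ 2 - X"
      by (simp_all add: X_def U_def V_def binom2_def field_simps power2_eq_square)
    have "U ^ Suc (Suc k) + V ^ Suc (Suc k) = (U + V) * (U ^ Suc k + V ^ Suc k) - U * V * (U ^ k + V ^ k)"
      by (simp add: algebra_simps)
    also have "\<dots> = (2 * X + 1) * (T X + 2 * X ^ Suc k) - (X ^ 2 - X) * (R X + 2 * X ^ k)"
    proof -
      have "U ^ k + V ^ k = R X + 2 * X ^ k" "U ^ Suc k + V ^ Suc k = T X + 2 * X ^ Suc k"
        using R(3)[of c] T(2)[of c] unfolding X_def U_def V_def by linarith+
      then show ?thesis by (simp only: UV)
    qed
    finally show ?thesis unfolding X_def[symmetric] U_def[symmetric] V_def[symmetric]
      by (simp add: algebra_simps power2_eq_square)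
  qed
  ultimately show ?case by (intro exI[of _ ?Z]) auto
qed

text \<open>The first difference at \<open>i\<close> is exchanged for the one at
  \<open>i + 1\<close>, which leaves a second difference at the content \<open>i + 1\<close>. For
  \<open>i = 0\<close> nothing is removed, in accordance with a vanishing first difference at
  0.\<close>

lemma qk_grow:
  assumes l: "strict_part l" "i \<in> insert 0 (set l)" "i + 1 \<notin> set l" and k: "1 \<le> k"
  shows "qk (grow i l) k = qk l k + (binom2 (int i + 1 + 1) ^ k + binom2 (int i + 1 - 1) ^ k - 2 * binom2 (int i + 1) ^ k)"
proof -
  let ?g = "\<lambda>a. binom2 (int a + 1) ^ k - binom2 (int a) ^ k"
  have g0: "?g 0 = 0" using k by (simp add: binom2_def)
  have "strict_part (grow i l)" using strict_part_grow l by blast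
  then have "qk (grow i l) k = sum ?g (insert (i + 1) (set l - {i}))"
    using k by (simp only: qk_eq set_grow[OF l(1,2)])
  also have "\<dots> = ?g (i + 1) + sum ?g (set l - {i})" using l by simp
  also have "sum ?g (set l - {i}) = qk l k - ?g i"
  proof (cases "i \<in> set l")
    case True
    then show ?thesis using k l by (simp add: qk_eq sum_diff1)
  next
    case False
    then show ?thesis using g0 k l by (simp add: qk_eq)
  qed
  finally show ?thesis by (simp add: algebra_simps)
qed

lemma mono_sym_eval_grow:
  assumes "strict_part l" "i \<in> insert 0 (set l)" "0 \<notin> set \<alpha>"
  shows "mono_sym_eval \<alpha> (diagram (grow i l)) content_binom = mono_sym_eval \<alpha> (diagram l) content_binom +
    (\<Sum>a\<in>set \<alpha>. mono_sym_eval (remove1 a \<alpha>) (diagram l) content_binom * binom2 (int i + 1) ^ a)"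
proof -
  obtain r where r: "(r + 1, r + i + 2) \<notin> diagram l" "diagram (grow i l) = insert (r + 1, r + i + 2) (diagram l)"
    using diagram_grow[OF assms(1,2)] by blast
  have "content_binom (r + 1, r + i + 2) = binom2 (int i + 1)"
    by (simp add: content_binom_def algebra_simps)
  then show ?thesis
    unfolding r(2) using mono_sym_eval_insert[OF finite_diagram r(1) assms(3), of content_binom] by (simp add: mult.commute)
qed

text \<open>The remainder sees the new box only through \<open>x\<close>, which later allows it to
  be averaged by moments. Truncated subtraction loses the drop from degree 0, so
  \<open>R = 0\<close> is recorded there separately.\<close>

lemma filt_grow:
  assumes "filt d F"
  shows "\<exists>R. (d = 0 \<longrightarrow> R = (\<lambda>_ _. 0)) \<and> xfilt (d - 1) R \<and>
    (\<forall>l i. strict_part l \<and> i \<in> insert 0 (set l) \<and> i + 1 \<notin> set l \<longrightarrow> F (grow i l) = F l + R l (binom2 (int i + 1)))"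
  using assms
proof (induction rule: filt.induct)
  case (filt_const c)
  show ?case by (intro exI[of _ "\<lambda>_ _. 0"]) (simp add: xfilt_0)
next
  case (filt_qk k)
  obtain R where R: "xfilt (k - 1) (\<lambda>_. R)"
    "\<And>c. binom2 (c + 1) ^ k + binom2 (c - 1) ^ k - 2 * binom2 c ^ k = R (binom2 c)"
    using binom2_second_difference[of k] by blast
  have "qk (grow i l) k = qk l k + R (binom2 (int i + 1))"
    if "strict_part l \<and> i \<in> insert 0 (set l) \<and> i + 1 \<notin> set l" for l i
    using qk_grow[of l i k] R(2)[of "int i + 1"] that filt_qk by simp
  then show ?case using R(1) filt_qk by (intro exI[of _ "\<lambda>_. R"]) auto
next
  case (filt_mono_sym \<alpha>)
  let ?R = "\<lambda>l x. \<Sum>a\<in>set \<alpha>. mono_sym_eval (remove1 a \<alpha>) (diagram l) content_binom * x ^ a"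
  \<comment> \<open>Dropping a part \<open>a\<close> lowers the degree by \<open>a + 1\<close>, and
    \<open>x ^ a\<close> gives back only \<open>a\<close>. The summand
    \<open>length \<alpha>\<close> in the degree serves this purpose.\<close>
  have "xfilt (sum_list \<alpha> + length \<alpha> - 1) ?R"
  proof (rule xfilt_sum)
    fix a assume a: "a \<in> set \<alpha>"
    have "0 \<notin> set (remove1 a \<alpha>)" using filt_mono_sym set_remove1_subset by fastforce
    from xfilt_monom[OF filt.filt_mono_sym[OF this], of a]
    have "xfilt (sum_list (remove1 a \<alpha>) + length (remove1 a \<alpha>) + a)
      (\<lambda>l x. mono_sym_eval (remove1 a \<alpha>) (diagram l) content_binom * x ^ a)" .
    moreover have "sum_list \<alpha> = a + sum_list (remove1 a \<alpha>)" by (rule sum_list_map_remove1[OF a, of "\<lambda>x. x", simplified])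
    moreover have "length (remove1 a \<alpha>) = length \<alpha> - 1" "0 < length \<alpha>" using a by (auto simp: length_remove1)
    ultimately show "xfilt (sum_list \<alpha> + length \<alpha> - 1) (\<lambda>l x. mono_sym_eval (remove1 a \<alpha>) (diagram l) content_binom * x ^ a)"
      by (simp add: algebra_simps)
  qed
  moreover have "?R = (\<lambda>_ _. 0)" if "sum_list \<alpha> + length \<alpha> = 0" using that by simp
  ultimately show ?case using mono_sym_eval_grow filt_mono_sym by (intro exI[of _ ?R]) auto
next
  case (filt_add d F G)
  then obtain R T where
    "(d = 0 \<longrightarrow> R = (\<lambda>_ _. 0))" "xfilt (d - 1) R"
    "\<And>l i. strict_part l \<and> i \<in> insert 0 (set l) \<and> i + 1 \<notin> set l \<Longrightarrow> F (grow i l) = F l + R l (binom2 (int i + 1))"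
    "(d = 0 \<longrightarrow> T = (\<lambda>_ _. 0))" "xfilt (d - 1) T"
    "\<And>l i. strict_part l \<and> i \<in> insert 0 (set l) \<and> i + 1 \<notin> set l \<Longrightarrow> G (grow i l) = G l + T l (binom2 (int i + 1))"
    by blast
  then show ?case by (intro exI[of _ "\<lambda>l x. R l x + T l x"]) (auto intro: xfilt_add)
next
  case (filt_mult d F e G)
  then obtain R T where R:
    "(d = 0 \<longrightarrow> R = (\<lambda>_ _. 0))" "xfilt (d - 1) R"
    "\<And>l i. strict_part l \<and> i \<in> insert 0 (set l) \<and> i + 1 \<notin> set l \<Longrightarrow> F (grow i l) = F l + R l (binom2 (int i + 1))" and T:
    "(e = 0 \<longrightarrow> T = (\<lambda>_ _. 0))" "xfilt (e - 1) T"
    "\<And>l i. strict_part l \<and> i \<in> insert 0 (set l) \<and> i + 1 \<notin> set l \<Longrightarrow> G (grow i l) = G l + T l (binom2 (int i + 1))"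
    by blast
  \<comment> \<open>This is \<open>(F + R) * (G + T) - F * G\<close>. A factor of degree 0 has no
    remainder, which settles the cases where \<open>d - 1\<close> or \<open>e - 1\<close> is
    truncated.\<close>
  let ?Z = "\<lambda>l x. F l * T l x + R l x * G l + R l x * T l x"
  have "xfilt (d + e - 1) (\<lambda>l x. F l * T l x)"
  proof (cases "e = 0")
    case False
    then show ?thesis using xfilt_mult[OF xfilt_coeff[OF filt_mult(1)] T(2)] by simp
  qed (use T(1) in \<open>simp add: xfilt_0\<close>)
  moreover have "xfilt (d + e - 1) (\<lambda>l x. R l x * G l)"
  proof (cases "d = 0")
    case False
    then show ?thesis using xfilt_mult[OF R(2) xfilt_coeff[OF filt_mult(2)]] by simp
  qed (use R(1) in \<open>simp add: xfilt_0\<close>)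
  moreover have "xfilt (d + e - 1) (\<lambda>l x. R l x * T l x)"
    by (rule xfilt_le[OF xfilt_mult[OF R(2) T(2)]]) simp
  ultimately have "xfilt (d + e - 1) ?Z" by (intro xfilt_add)
  moreover have "?Z = (\<lambda>_ _. 0)" if "d + e = 0" using R(1) T(1) that by simp
  ultimately show ?case using R(3) T(3) by (intro exI[of _ ?Z]) (auto simp: algebra_simps)
next
  case (filt_le d F e)
  then obtain R where R:
    "(d = 0 \<longrightarrow> R = (\<lambda>_ _. 0))" "xfilt (d - 1) R"
    "\<And>l i. strict_part l \<and> i \<in> insert 0 (set l) \<and> i + 1 \<notin> set l \<Longrightarrow> F (grow i l) = F l + R l (binom2 (int i + 1))"
    by blast
  have "xfilt (e - 1) R" using xfilt_le[OF R(2)] filt_le(2) by simp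
  then show ?case using R filt_le(2) by (intro exI[of _ R]) auto
qed

section \<open>Averages over added boxes, and iterates of \<open>Dop\<close>\<close>

text \<open>\<open>qk_eq\<close> identifies the power sums of Newton's identity with the
  \<open>q_j\<close>, and \<open>q_j\<close> times the moment \<open>k - j\<close> has degree
  \<open>k\<close>. This identification is confined to strict partitions, hence the separate witness
  \<open>h\<close>.\<close>

lemma filt_growth_moment:
  "\<exists>h. filt k h \<and> (\<forall>l. strict_part l \<longrightarrow> growth_moment (set l) k = h l)"
proof (induction k rule: less_induct)
  case (less k)
  have z: "finite (set l)" "0 \<notin> set l" if "strict_part l" for l using strict_part_pos[OF that] by auto
  show ?case
  proof (cases "k = 0")
    case True
    then show ?thesis using growth_moment_0[OF z] filt_const by blast
  next
    case False
    obtain h where h: "\<And>j. j < k \<Longrightarrow> filt j (h j)"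
      "\<And>j l. j < k \<Longrightarrow> strict_part l \<Longrightarrow> growth_moment (set l) j = h j l"
      using less by metis
    let ?h = "\<lambda>l. (1 / real k) * (\<Sum>j=1..k. qk l j * h (k - j) l)"
    have "filt k ?h"
    proof (intro filt_cmult filt_sum)
      fix j assume "j \<in> {1..k}"
      then show "filt k (\<lambda>l. qk l j * h (k - j) l)"
        using filt_mult[OF filt_qk h(1), of j "k - j"] by simp
    qed
    moreover have "growth_moment (set l) k = ?h l" if l: "strict_part l" for l
    proof -
      have "real k * growth_moment (set l) k = (\<Sum>j=1..k. qk l j * h (k - j) l)"
        unfolding growth_moment_newton[OF z[OF l]]
        using h(2) l False by (intro sum.cong) (auto simp: qk_eq)
      then show ?thesis using False by (simp add: field_simps)
    qed
    ultimately show ?thesis by blast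
  qed
qed

text \<open>The average of \<open>x ^ j\<close> is a moment of the same degree \<open>j\<close>, so
  averaging never raises the degree.\<close>

lemma xfilt_growth_average:
  assumes "xfilt d R"
  shows "\<exists>F. filt d F \<and> (\<forall>l. strict_part l \<longrightarrow>
    (\<Sum>i\<in>insert 0 (set l). growth_weight (set l) i * R l (binom2 (int i + 1))) = F l)"
  using assms
proof (induction rule: xfilt.induct)
  case (xfilt_monom d F j)
  obtain h where h: "filt j h" "\<And>l. strict_part l \<Longrightarrow> growth_moment (set l) j = h l"
    using filt_growth_moment by blast
  have "(\<Sum>i\<in>insert 0 (set l). growth_weight (set l) i * (F l * binom2 (int i + 1) ^ j)) = F l * h l"
    if "strict_part l" for l
    unfolding h(2)[OF that, symmetric] growth_moment_def sum_distrib_left by (intro sum.cong) auto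
  then show ?case using filt_mult[OF xfilt_monom h(1)] by blast
next
  case (xfilt_add d R T)
  then obtain F G where "filt d F" "filt d G"
    "\<And>l. strict_part l \<Longrightarrow> (\<Sum>i\<in>insert 0 (set l). growth_weight (set l) i * R l (binom2 (int i + 1))) = F l"
    "\<And>l. strict_part l \<Longrightarrow> (\<Sum>i\<in>insert 0 (set l). growth_weight (set l) i * T l (binom2 (int i + 1))) = G l"
    by blast
  then show ?case
    by (intro exI[of _ "\<lambda>l. F l + G l"] conjI allI impI filt_add) (simp_all only: distrib_left sum.distrib)
next
  case (xfilt_le d R e)
  then show ?case using filt_le by blast
qed

text \<open>Since the weights have sum 1, subtracting \<open>F l\<close> leaves the average of the
  remainder. Degree 0 gives exactly 0, which ends the iteration after \<open>d + 1\<close>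
  steps.\<close>

lemma Dop_filt:
  assumes "filt d F"
  shows "\<exists>G. (d = 0 \<longrightarrow> G = (\<lambda>_. 0)) \<and> filt (d - 1) G \<and>
    (\<forall>l. strict_part l \<longrightarrow> Dop (\<lambda>k. F k / real (H k)) l = G l / real (H l))"
proof -
  obtain R where R: "d = 0 \<longrightarrow> R = (\<lambda>_ _. 0)" "xfilt (d - 1) R"
    "\<And>l i. strict_part l \<and> i \<in> insert 0 (set l) \<and> i + 1 \<notin> set l \<Longrightarrow> F (grow i l) = F l + R l (binom2 (int i + 1))"
    using filt_grow[OF assms] by blast
  obtain G where G: "filt (d - 1) G"
    "\<And>l. strict_part l \<Longrightarrow> (\<Sum>i\<in>insert 0 (set l). growth_weight (set l) i * R l (binom2 (int i + 1))) = G l"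
    using xfilt_growth_average[OF R(2)] by blast
  have D: "Dop (\<lambda>k. F k / real (H k)) l =
      (\<Sum>i\<in>insert 0 (set l). growth_weight (set l) i * R l (binom2 (int i + 1))) / real (H l)"
    if l: "strict_part l" for l
  proof -
    have z: "finite (set l)" "0 \<notin> set l" using strict_part_pos[OF l] by auto
    have "(\<Sum>i\<in>insert 0 (set l). growth_weight (set l) i * F (grow i l)) =
      (\<Sum>i\<in>insert 0 (set l). growth_weight (set l) i * F l + growth_weight (set l) i * R l (binom2 (int i + 1)))"
    proof (intro sum.cong refl)
      fix i assume i: "i \<in> insert 0 (set l)"
      show "growth_weight (set l) i * F (grow i l) =
        growth_weight (set l) i * F l + growth_weight (set l) i * R l (binom2 (int i + 1))"
      proof (cases "i + 1 \<in> set l")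
        case True
        then have "growth_weight (set l) i = 0" using growth_weight_eq_0[OF z(1)] by blast
        then show ?thesis by simp
      next
        case False
        then show ?thesis using R(3)[of l i] i l by (simp add: distrib_left)
      qed
    qed
    also have "\<dots> = F l + (\<Sum>i\<in>insert 0 (set l). growth_weight (set l) i * R l (binom2 (int i + 1)))"
      using growth_moment_0[OF z] unfolding growth_moment_def sum.distrib sum_distrib_right[symmetric] by simp
    finally show ?thesis unfolding Dop_div_H[OF l] by simp
  qed
  show ?thesis
  proof (cases "d = 0")
    case True
    then show ?thesis using D R(1) by (intro exI[of _ "\<lambda>_. 0"]) (simp add: filt_const')
  next
    case False
    then show ?thesis using D G by (intro exI[of _ G]) simp
  qed
qed

text \<open>At a strict partition \<open>Dop\<close> evaluates its argument at strict partitions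
  only, so identities confined to these survive iteration.\<close>

lemma Dop_cong:
  assumes "\<And>l. strict_part l \<Longrightarrow> F l = G l" "strict_part l"
  shows "Dop F l = Dop G l"
  using assms by (simp add: Dop_def plus_boxes_def)

lemma Dop_funpow_cong:
  assumes "\<And>l. strict_part l \<Longrightarrow> F l = G l" "strict_part l"
  shows "(Dop ^^ n) F l = (Dop ^^ n) G l"
  using assms(2)
proof (induction n arbitrary: l)
  case (Suc n)
  then show ?case using Dop_cong[of "(Dop ^^ n) F" "(Dop ^^ n) G"] by simp
qed (use assms in auto)

lemma Dop_funpow_filt:
  assumes "filt d F" "strict_part l"
  shows "(Dop ^^ (d + 1)) (\<lambda>k. F k / real (H k)) l = 0"
  using assms
proof (induction d arbitrary: F l)
  case 0
  then show ?case using Dop_filt[OF 0(1)] by auto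
next
  case (Suc d)
  obtain G where G: "filt d G" "\<And>l. strict_part l \<Longrightarrow> Dop (\<lambda>k. F k / real (H k)) l = G l / real (H l)"
    using Dop_filt[OF Suc.prems(1)] by auto
  have "(Dop ^^ (Suc d + 1)) (\<lambda>k. F k / real (H k)) l = (Dop ^^ (d + 1)) (Dop (\<lambda>k. F k / real (H k))) l"
    by (simp add: funpow_swap1)
  also have "\<dots> = (Dop ^^ (d + 1)) (\<lambda>k. G k / real (H k)) l"
    using G(2) Suc.prems(2) by (rule Dop_funpow_cong)
  finally show ?case using Suc.IH[OF G(1) Suc.prems(2)] by simp
qed

lemma filt_sym_eval:
  assumes "is_symfun Q"
  shows "\<exists>d. filt d (\<lambda>l. sym_eval Q (diagram l) content_binom)"
proof -
  have "\<exists>d. filt d (\<lambda>l. \<Sum>\<alpha>\<in>A. Q \<alpha> * mono_sym_eval \<alpha> (diagram l) content_binom)"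
    if "finite A" "A \<subseteq> {\<alpha>. Q \<alpha> \<noteq> 0}" for A
    using that
  proof (induction rule: finite_induct)
    case empty
    show ?case using filt_const by auto
  next
    case (insert \<alpha> A)
    obtain d where d: "filt d (\<lambda>l. \<Sum>\<alpha>\<in>A. Q \<alpha> * mono_sym_eval \<alpha> (diagram l) content_binom)"
      using insert by auto
    have "0 \<notin> set \<alpha>" using insert assms by (auto simp: is_symfun_def int_partition_def)
    then have "filt (sum_list \<alpha> + length \<alpha>) (\<lambda>l. Q \<alpha> * mono_sym_eval \<alpha> (diagram l) content_binom)"
      by (intro filt_cmult filt_mono_sym)
    then have "filt (sum_list \<alpha> + length \<alpha> + d) (\<lambda>l. Q \<alpha> * mono_sym_eval \<alpha> (diagram l) content_binom +
       (\<Sum>\<alpha>\<in>A. Q \<alpha> * mono_sym_eval \<alpha> (diagram l) content_binom))"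
      by (intro filt_add filt_le[OF d]) (auto elim: filt_le)
    then show ?case using insert by auto
  qed
  then show ?thesis using assms by (simp add: is_symfun_def sym_eval_def)
qed

lemma filt_qnu: "0 \<notin> set \<nu> \<Longrightarrow> filt (sum_list \<nu>) (qnu \<nu>)"
proof (induction \<nu>)
  case Nil
  then show ?case by (simp add: qnu_def filt_const)
next
  case (Cons k \<nu>)
  then have "filt (k + sum_list \<nu>) (\<lambda>l. qk l k * qnu \<nu> l)" by (intro filt_mult filt_qk) auto
  then show ?case by (simp add: qnu_def)
qed

section \<open>Standard shifted tableaux and the polynomial\<close>

lemma diagram_closed:
  assumes "strict_part l" "(i', j') \<in> diagram l" "1 \<le> i" "i \<le> i'" "i < j" "j \<le> j'"
  shows "(i, j) \<in> diagram l"
proof -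
  have "i' \<le> length l" "j' \<le> i' + part_at l i'" using assms(2) by (auto simp: diagram_def)
  then have "j \<le> i + part_at l i"
    using part_at_shift_mono[OF assms(1,3,4)] assms(6) by linarith
  then show ?thesis using assms by (simp add: part_at_diagram)
qed

lemma diagram_inject: "strict_part k \<Longrightarrow> strict_part l \<Longrightarrow> diagram k = diagram l \<Longrightarrow> k = l"
  using contains_sum_eq[of l k] contains_iff_diagram[of k l] card_diagram[of k] card_diagram[of l] by simp

text \<open>The fillings of \<open>num_syt\<close> over an arbitrary set of boxes, so that a single
  box can be added or removed without naming a shape.\<close>

definition syt :: "(nat \<times> nat) set \<Rightarrow> (nat \<times> nat \<Rightarrow> nat) set" where
  "syt A = {T. bij_betw T A {1..card A} \<and> (\<forall>x. x \<notin> A \<longrightarrow> T x = 0) \<and>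
      (\<forall>i j j'. (i, j) \<in> A \<longrightarrow> (i, j') \<in> A \<longrightarrow> j < j' \<longrightarrow> T (i, j) < T (i, j')) \<and>
      (\<forall>i i' j. (i, j) \<in> A \<longrightarrow> (i', j) \<in> A \<longrightarrow> i < i' \<longrightarrow> T (i, j) < T (i', j))}"

lemma num_syt_eq: "num_syt l m = card (syt (skew l m))"
  by (simp add: num_syt_def syt_def)

lemma finite_syt:
  assumes "finite A"
  shows "finite (syt A)"
proof (rule finite_subset)
  show "syt A \<subseteq> {T. \<forall>x. (x \<in> A \<longrightarrow> T x \<in> {1..card A}) \<and> (x \<notin> A \<longrightarrow> T x = 0)}"
    by (auto simp: syt_def dest: bij_betwE)
  show "finite {T. \<forall>x. (x \<in> A \<longrightarrow> T x \<in> {1..card A}) \<and> (x \<notin> A \<longrightarrow> T x = (0::nat))}"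
    using assms by (intro finite_set_of_finite_funs) auto
qed

lemma syt_empty: "syt {} = {\<lambda>_. 0}"
  by (auto simp: syt_def bij_betw_def)

lemma syt_less_row: "T \<in> syt A \<Longrightarrow> (i, j) \<in> A \<Longrightarrow> (i, j') \<in> A \<Longrightarrow> j < j' \<Longrightarrow> T (i, j) < T (i, j')"
  by (auto simp: syt_def)

lemma syt_less_column: "T \<in> syt A \<Longrightarrow> (i, j) \<in> A \<Longrightarrow> (i', j) \<in> A \<Longrightarrow> i < i' \<Longrightarrow> T (i, j) < T (i', j)"
  by (auto simp: syt_def)

lemma syt_outside: "T \<in> syt A \<Longrightarrow> x \<notin> A \<Longrightarrow> T x = 0"
  unfolding syt_def by blast

lemma syt_insert:
  assumes T: "T \<in> syt A" and A: "finite A" "(i, j) \<notin> A"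
    and last: "\<And>j'. (i, j') \<in> A \<Longrightarrow> j' \<le> j" "\<And>i'. (i', j) \<in> A \<Longrightarrow> i' \<le> i"
  shows "T((i, j) := card A + 1) \<in> syt (insert (i, j) A)"
proof -
  let ?T = "T((i, j) := card A + 1)"
  have bij: "bij_betw T A {1..card A}" using T by (simp add: syt_def)
  have le: "T x \<le> card A" if "x \<in> A" for x using bij_betwE[OF bij] that by auto
  have "bij_betw ?T A {1..card A}" using bij A by (subst bij_betw_cong[where g = T]) auto
  then have "bij_betw ?T (A \<union> {(i, j)}) ({1..card A} \<union> {card A + 1})"
    using A notIn_Un_bij_betw[of "(i, j)" A ?T "{1..card A}"] by simp
  moreover have "{1..card A} \<union> {card A + 1} = {1..card (insert (i, j) A)}" using A by auto
  ultimately have 1: "bij_betw ?T (insert (i, j) A) {1..card (insert (i, j) A)}" by simp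
  have 2: "?T (a, b) < ?T (a, b')" if "(a, b) \<in> insert (i, j) A" "(a, b') \<in> insert (i, j) A" "b < b'" for a b b'
  proof -
    have "(a, b) \<noteq> (i, j)" using that last(1)[of b'] by auto
    then show ?thesis using that T le[of "(a, b)"] by (auto simp: syt_def)
  qed
  have 3: "?T (a, b) < ?T (a', b)" if "(a, b) \<in> insert (i, j) A" "(a', b) \<in> insert (i, j) A" "a < a'" for a a' b
  proof -
    have "(a, b) \<noteq> (i, j)" using that last(2)[of a'] by auto
    then show ?thesis using that T le[of "(a, b)"] by (auto simp: syt_def)
  qed
  have 4: "?T x = 0" if "x \<notin> insert (i, j) A" for x using that syt_outside[OF T] by simp
  show ?thesis unfolding syt_def using 1 2 3 4 by blast
qed

lemma syt_remove_max:
  assumes T: "T \<in> syt A" and A: "finite A" "b \<in> A" "T b = card A"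
  shows "T(b := 0) \<in> syt (A - {b})"
proof -
  have "1 \<le> card A" using A by (auto simp: Suc_le_eq card_gt_0_iff)
  then have "bij_betw T (A - {b}) ({1..card A} - {T b})"
    using T A by (intro bij_betw_DiffI) (auto simp: syt_def bij_betw_def)
  moreover have "{1..card A} - {T b} = {1..card (A - {b})}" using A by (auto simp: card_Diff_singleton)
  ultimately have "bij_betw (T(b := 0)) (A - {b}) {1..card (A - {b})}"
    by (subst bij_betw_cong[where g = T]) auto
  then show ?thesis using T unfolding syt_def by auto
qed

text \<open>Neither the right nor the lower neighbour of \<open>b\<close> lies in \<open>k\<close>:
  in \<open>\<mu>\<close> it would force \<open>b\<close> into \<open>\<mu>\<close>, and in the skew
  shape it would carry a larger entry. So \<open>b\<close> ends its row, and no part blocks its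
  removal.\<close>

lemma syt_max_corner:
  assumes k: "strict_part k" and \<mu>: "strict_part \<mu>"
    and T: "T \<in> syt (skew k \<mu>)" and b: "b \<in> skew k \<mu>" "T b = card (skew k \<mu>)"
  shows "b \<in> outer_corners k"
proof -
  obtain i j where ij: "b = (i, j)" by (cases b)
  have d: "(i, j) \<in> diagram k" "(i, j) \<notin> diagram \<mu>" using b ij by (auto simp: skew_def)
  have i: "1 \<le> i" "i \<le> length k" "i < j" "j \<le> i + part_at k i" using d(1) by (auto simp: diagram_def)
  have le: "T x \<le> T b" if "x \<in> skew k \<mu>" for x
    using T that b by (auto simp: syt_def dest: bij_betwE)
  have "j = i + part_at k i"
  proof (rule ccontr)
    assume "j \<noteq> i + part_at k i"
    then have "(i, j + 1) \<in> diagram k" using i by (simp add: part_at_diagram)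
    moreover have "(i, j + 1) \<notin> diagram \<mu>" using diagram_closed[OF \<mu>, of i "j + 1" i j] d(2) i by auto
    ultimately have s: "(i, j + 1) \<in> skew k \<mu>" by (simp add: skew_def)
    then have "T (i, j) < T (i, j + 1)" using syt_less_row[OF T b(1)[unfolded ij] s] by simp
    then show False using le[OF s] ij by simp
  qed
  \<comment> \<open>A part smaller by one would stand in a later row \<open>s\<close>, ending in
    column \<open>s + part_at k s \<ge> j\<close>; closure of the diagram would then put the lower
    neighbour of \<open>b\<close> into \<open>k\<close>.\<close>
  moreover have "part_at k i - 1 \<notin> set k"
  proof
    assume "part_at k i - 1 \<in> set k"
    then obtain s where s: "1 \<le> s" "s \<le> length k" "part_at k s = part_at k i - 1"
      using bij_betw_imp_surj_on[OF bij_part_at[OF k], symmetric] by auto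
    have pos: "0 < part_at k s" using part_at_pos[OF k s(1,2)] .
    have "i < s"
    proof (rule ccontr)
      assume "\<not> i < s"
      then have "i + part_at k i \<le> s + part_at k s" using part_at_shift_mono[OF k s(1), of i] i by simp
      then show False using s pos \<open>\<not> i < s\<close> by linarith
    qed
    have "(s, s + part_at k s) \<in> diagram k" using s(1) pos by (simp add: part_at_diagram)
    moreover have "i + 1 < j" "j \<le> s + part_at k s"
      using \<open>j = i + part_at k i\<close> \<open>i < s\<close> s(3) pos by linarith+
    ultimately have "(i + 1, j) \<in> diagram k"
      using diagram_closed[OF k, of s "s + part_at k s" "i + 1" j] \<open>i < s\<close> by simp
    moreover have "(i + 1, j) \<notin> diagram \<mu>" using diagram_closed[OF \<mu>, of "i + 1" j i j] d(2) i(1,3) by auto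
    ultimately have s: "(i + 1, j) \<in> skew k \<mu>" by (simp add: skew_def)
    then have "T (i, j) < T (i + 1, j)" using syt_less_column[OF T b(1)[unfolded ij] s] by simp
    then show False using le[OF s] ij by simp
  qed
  ultimately have "i \<in> corner_rows k" "b = (i, i + part_at k i)"
    using i(1,2) ij by (simp_all add: corner_rows_def)
  then show ?thesis unfolding outer_corners_eq[OF k] by blast
qed

section \<open>Shapes of given size and the branching rule\<close>

definition level :: "nat list \<Rightarrow> nat \<Rightarrow> nat list set" where
  "level \<mu> n = {l. strict_part l \<and> contains l \<mu> \<and> sum_list l = sum_list \<mu> + n}"

lemma length_le_sum_list: "strict_part l \<Longrightarrow> length l \<le> sum_list l"
  by (induction l) auto

lemma finite_level: "finite (level \<mu> n)"
proof (rule finite_subset)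
  show "level \<mu> n \<subseteq> {l. set l \<subseteq> {..sum_list \<mu> + n} \<and> length l \<le> sum_list \<mu> + n}"
    by (auto simp: level_def dest: length_le_sum_list member_le_sum_list)
qed (rule finite_lists_length_le, simp)

lemma level_0: "strict_part \<mu> \<Longrightarrow> level \<mu> 0 = {\<mu>}"
  using contains_sum_eq[of \<mu>] contains_refl by (auto simp: level_def)

lemma card_skew: "l \<in> level \<mu> n \<Longrightarrow> card (skew l \<mu>) = n"
  by (auto simp: level_def skew_def contains_iff_diagram card_Diff_subset card_diagram)

lemma finite_skew: "finite (skew l \<mu>)"
  by (simp add: skew_def)

lemma plus_boxes_level:
  assumes "l \<in> level \<mu> n" "k \<in> plus_boxes l"
  shows "k \<in> level \<mu> (Suc n)"
proof -
  have "contains k \<mu>" using assms by (auto simp: level_def plus_boxes_def contains_iff_diagram)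
  then show ?thesis using assms by (auto simp: level_def plus_boxes_def)
qed

text \<open>The box holding the largest entry \<open>Suc n\<close> is an outer corner of
  \<open>k\<close>, and deleting it leaves a tableau on a smaller shape \<open>l\<close>; conversely
  \<open>Suc n\<close> may be put into any box that extends \<open>l\<close> to
  \<open>k\<close>.\<close>

lemma num_syt_Suc:
  assumes \<mu>: "strict_part \<mu>" and k: "k \<in> level \<mu> (Suc n)"
  shows "num_syt k \<mu> = (\<Sum>l\<in>{l. l \<in> level \<mu> n \<and> k \<in> plus_boxes l}. num_syt l \<mu>)"
proof -
  let ?P = "{l. l \<in> level \<mu> n \<and> k \<in> plus_boxes l}"
  have sk: "strict_part k" using k by (simp add: level_def)
  have ck: "card (skew k \<mu>) = Suc n" using card_skew[OF k] .
  have "\<exists>b. b \<notin> diagram l \<and> diagram k = insert b (diagram l)" if "l \<in> ?P" for l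
    using that unfolding plus_boxes_iff_diagram by blast
  then have "\<forall>l\<in>?P. \<exists>b. b \<notin> diagram l \<and> diagram k = insert b (diagram l)" by blast
  then obtain \<beta> where \<beta>: "\<And>l. l \<in> ?P \<Longrightarrow> \<beta> l \<notin> diagram l" "\<And>l. l \<in> ?P \<Longrightarrow> diagram k = insert (\<beta> l) (diagram l)"
    unfolding bchoice_iff by blast
  have skew_k: "skew k \<mu> = insert (\<beta> l) (skew l \<mu>)" "\<beta> l \<notin> skew l \<mu>" if l: "l \<in> ?P" for l
  proof -
    have "diagram \<mu> \<subseteq> diagram l" using l by (auto simp: level_def contains_iff_diagram)
    then show "skew k \<mu> = insert (\<beta> l) (skew l \<mu>)" using \<beta>[OF l] by (auto simp: skew_def)
    show "\<beta> l \<notin> skew l \<mu>" using \<beta>(1)[OF l] by (simp add: skew_def)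
  qed
  have up: "T(\<beta> l := Suc n) \<in> syt (skew k \<mu>)" if l: "l \<in> ?P" and T: "T \<in> syt (skew l \<mu>)" for l T
  proof -
    obtain i j where ij: "\<beta> l = (i, j)" by (cases "\<beta> l")
    have sl: "strict_part l" using l by (simp add: level_def)
    have ijk: "1 \<le> i" "i < j" using \<beta>(2)[OF l] ij part_at_diagram[of i j k] by auto
    have "j' \<le> j" if "(i, j') \<in> skew l \<mu>" for j'
      using diagram_closed[OF sl, of i j' i j] that ijk \<beta>(1)[OF l] ij by (cases "j' \<le> j") (auto simp: skew_def)
    moreover have "i' \<le> i" if "(i', j) \<in> skew l \<mu>" for i'
      using diagram_closed[OF sl, of i' j i j] that ijk \<beta>(1)[OF l] ij by (cases "i' \<le> i") (auto simp: skew_def)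
    moreover have "card (skew l \<mu>) = n" using l card_skew by blast
    ultimately show ?thesis
      using syt_insert[OF T finite_skew, of i j] skew_k[OF l] ij by simp
  qed
  have "syt (skew k \<mu>) = (\<Union>l\<in>?P. (\<lambda>T. T(\<beta> l := Suc n)) ` syt (skew l \<mu>))"
  proof (intro equalityI subsetI)
    fix T assume T: "T \<in> syt (skew k \<mu>)"
    then have bij: "bij_betw T (skew k \<mu>) {1..Suc n}" using ck by (simp add: syt_def)
    then have "Suc n \<in> T ` skew k \<mu>" using bij_betw_imp_surj_on by fastforce
    then obtain b where b: "b \<in> skew k \<mu>" "T b = Suc n" by auto
    have "b \<in> outer_corners k" using syt_max_corner[OF sk \<mu> T b(1)] b(2) ck by simp
    then obtain l where l: "b \<in> diagram k" "strict_part l" "diagram l = diagram k - {b}"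
      by (auto simp: outer_corners_def)
    then have bl: "b \<notin> diagram l" "diagram k = insert b (diagram l)" by auto
    then have kl: "k \<in> plus_boxes l" unfolding plus_boxes_iff_diagram using sk by blast
    have "diagram \<mu> \<subseteq> diagram l" using k b(1) l(3) by (auto simp: level_def contains_iff_diagram skew_def)
    then have "l \<in> level \<mu> n" using kl l(2) k by (auto simp: level_def contains_iff_diagram plus_boxes_def)
    then have lP: "l \<in> ?P" using kl by simp
    then have "b = \<beta> l" using \<beta>[OF lP] bl by blast
    have "T(b := 0) \<in> syt (skew k \<mu> - {b})"
      using T finite_skew b ck by (intro syt_remove_max) auto
    moreover have "skew k \<mu> - {b} = skew l \<mu>" using skew_k[OF lP] \<open>b = \<beta> l\<close> by auto
    moreover have "T = (T(b := 0))(\<beta> l := Suc n)" using b \<open>b = \<beta> l\<close> by auto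
    ultimately show "T \<in> (\<Union>l\<in>?P. (\<lambda>T. T(\<beta> l := Suc n)) ` syt (skew l \<mu>))"
      using lP by (metis (no_types, lifting) UN_iff image_eqI)
  qed (use up in blast)
  then have "num_syt k \<mu> = card (\<Union>l\<in>?P. (\<lambda>T. T(\<beta> l := Suc n)) ` syt (skew l \<mu>))"
    by (simp add: num_syt_eq)
  also have "\<dots> = (\<Sum>l\<in>?P. card ((\<lambda>T. T(\<beta> l := Suc n)) ` syt (skew l \<mu>)))"
  proof (rule card_UN_disjoint)
    show "\<forall>l\<in>?P. \<forall>l'\<in>?P. l \<noteq> l' \<longrightarrow>
      (\<lambda>T. T(\<beta> l := Suc n)) ` syt (skew l \<mu>) \<inter> (\<lambda>T. T(\<beta> l' := Suc n)) ` syt (skew l' \<mu>) = {}"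
    proof (intro ballI impI, rule ccontr)
      fix l l' assume l: "l \<in> ?P" "l' \<in> ?P" "l \<noteq> l'"
        and "(\<lambda>T. T(\<beta> l := Suc n)) ` syt (skew l \<mu>) \<inter> (\<lambda>T. T(\<beta> l' := Suc n)) ` syt (skew l' \<mu>) \<noteq> {}"
      then obtain T T' where T: "T \<in> syt (skew l \<mu>)" "T(\<beta> l := Suc n) = T'(\<beta> l' := Suc n)" by blast
      \<comment> \<open>The position of \<open>Suc n\<close> determines the removed box, hence
        \<open>diagram l\<close>, hence \<open>l\<close>.\<close>
      let ?T = "T(\<beta> l := Suc n)"
      have "?T (\<beta> l) = ?T (\<beta> l')" using T(2) by (metis fun_upd_same)
      moreover have "inj_on ?T (skew k \<mu>)" using up[OF l(1) T(1)] by (auto simp: syt_def bij_betw_def)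
      moreover have "\<beta> l \<in> skew k \<mu>" "\<beta> l' \<in> skew k \<mu>" using skew_k(1)[OF l(1)] skew_k(1)[OF l(2)] by auto
      ultimately have "\<beta> l = \<beta> l'" by (meson inj_onD)
      then have "diagram l = diagram l'" using \<beta>[OF l(1)] \<beta>[OF l(2)] by (metis Diff_insert_absorb)
      then show False using diagram_inject[of l l'] l by (simp add: level_def)
    qed
  qed (use finite_level in \<open>auto intro: finite_syt finite_skew\<close>)
  also have "\<dots> = (\<Sum>l\<in>?P. num_syt l \<mu>)"
  proof (intro sum.cong refl)
    fix l assume l: "l \<in> ?P"
    have "inj_on (\<lambda>T. T(\<beta> l := Suc n)) (syt (skew l \<mu>))"
    proof (rule inj_onI)
      fix T T' assume *: "T \<in> syt (skew l \<mu>)" "T' \<in> syt (skew l \<mu>)" "T(\<beta> l := Suc n) = T'(\<beta> l := Suc n)"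
      have "T (\<beta> l) = 0" "T' (\<beta> l) = 0" using syt_outside *(1,2) skew_k(2)[OF l] by blast+
      then show "T = T'" using *(3) by (metis fun_upd_triv fun_upd_upd)
    qed
    then show "card ((\<lambda>T. T(\<beta> l := Suc n)) ` syt (skew l \<mu>)) = num_syt l \<mu>"
      by (simp add: card_image num_syt_eq)
  qed
  finally show ?thesis .
qed

section \<open>Powers of the weighted up operator\<close>

definition Uop :: "(nat list \<Rightarrow> real) \<Rightarrow> nat list \<Rightarrow> real" where
  "Uop G l = Dop G l + G l"

text \<open>The weight common to all chains of one-box additions from \<open>\<mu>\<close> to
  \<open>l\<close>: a factor 2 for each box that opens no new row.\<close>

definition path_weight :: "nat list \<Rightarrow> nat list \<Rightarrow> real" where
  "path_weight l \<mu> = 2 powi (int (sum_list l) - int (sum_list \<mu>) - int (length l) + int (length \<mu>))"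

lemma length_plus_boxes: "strict_part l \<Longrightarrow> k \<in> plus_boxes l \<Longrightarrow> length k = length l \<or> length k = length l + 1"
  by (auto simp: plus_boxes_eq length_grow split: if_splits)

lemma finite_plus_boxes: "strict_part l \<Longrightarrow> finite (plus_boxes l)"
  by (simp add: plus_boxes_eq)

lemma path_weight_plus_boxes:
  assumes "strict_part l" "k \<in> plus_boxes l"
  shows "path_weight k \<mu> = path_weight l \<mu> * (if length k > length l then 1 else 2)"
proof -
  have s: "sum_list k = sum_list l + 1" using assms by (simp add: plus_boxes_def)
  show ?thesis
  proof (cases "length k > length l")
    case True
    then have "length k = length l + 1" using length_plus_boxes[OF assms] by auto
    then have "path_weight k \<mu> = path_weight l \<mu>"
      unfolding path_weight_def s by (intro arg_cong[where f = "\<lambda>x. 2 powi x"]) simp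
    then show ?thesis using True by simp
  next
    case False
    then have "length k = length l" using length_plus_boxes[OF assms] by auto
    then have "path_weight k \<mu> = 2 powi ((int (sum_list l) - int (sum_list \<mu>) - int (length l) + int (length \<mu>)) + 1)"
      unfolding path_weight_def s by (intro arg_cong[where f = "\<lambda>x. 2 powi x"]) simp
    also have "\<dots> = path_weight l \<mu> * 2" unfolding path_weight_def by (subst power_int_add) auto
    finally show ?thesis using False by simp
  qed
qed

lemma Uop_eq:
  assumes "strict_part l"
  shows "Uop G l = (\<Sum>k\<in>plus_boxes l. (if length k > length l then 1 else 2) * G k)"
proof -
  have "plus_boxes l = {k \<in> plus_boxes l. length k > length l} \<union> {k \<in> plus_boxes l. length k = length l}"
    using length_plus_boxes[OF assms] by fastforce
  then have "(\<Sum>k\<in>plus_boxes l. (if length k > length l then 1 else 2) * G k) =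
    (\<Sum>k\<in>{k \<in> plus_boxes l. length k > length l} \<union> {k \<in> plus_boxes l. length k = length l}. (if length k > length l then 1 else 2) * G k)"
    by (rule arg_cong)
  also have "\<dots> = (\<Sum>k\<in>{k \<in> plus_boxes l. length k > length l}. G k) + 2 * (\<Sum>k\<in>{k \<in> plus_boxes l. length k = length l}. G k)"
    using finite_plus_boxes[OF assms] by (subst sum.union_disjoint) (auto simp: sum_distrib_left)
  finally show ?thesis by (simp add: Uop_def Dop_def)
qed

text \<open>A standard tableau is a chain of one-box additions, and the weight of a chain depends on
  its end points only.\<close>

lemma Uop_funpow:
  assumes \<mu>: "strict_part \<mu>"
  shows "(Uop ^^ n) G \<mu> = (\<Sum>l\<in>level \<mu> n. path_weight l \<mu> * real (num_syt l \<mu>) * G l)"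
proof (induction n arbitrary: G)
  case 0
  have "num_syt \<mu> \<mu> = 1" by (simp add: num_syt_eq skew_def syt_empty)
  then show ?case using level_0[OF \<mu>] by (simp add: path_weight_def)
next
  case (Suc n)
  \<comment> \<open>Peeling off the innermost \<open>Uop\<close> keeps the base point
    \<open>\<mu>\<close> fixed; for this \<open>G\<close> is arbitrary in the induction.\<close>
  have "(Uop ^^ Suc n) G \<mu> = (Uop ^^ n) (Uop G) \<mu>" by (simp add: funpow_swap1)
  also have "\<dots> = (\<Sum>l\<in>level \<mu> n. path_weight l \<mu> * real (num_syt l \<mu>) * Uop G l)" by (rule Suc)
  also have "\<dots> = (\<Sum>l\<in>level \<mu> n. \<Sum>k | k \<in> level \<mu> (Suc n) \<and> k \<in> plus_boxes l. path_weight k \<mu> * real (num_syt l \<mu>) * G k)"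
  proof (intro sum.cong refl)
    fix l assume l: "l \<in> level \<mu> n"
    then have sl: "strict_part l" by (simp add: level_def)
    have "{k. k \<in> level \<mu> (Suc n) \<and> k \<in> plus_boxes l} = plus_boxes l" using plus_boxes_level[OF l] by auto
    then show "path_weight l \<mu> * real (num_syt l \<mu>) * Uop G l =
      (\<Sum>k | k \<in> level \<mu> (Suc n) \<and> k \<in> plus_boxes l. path_weight k \<mu> * real (num_syt l \<mu>) * G k)"
      unfolding Uop_eq[OF sl] sum_distrib_left
      by (simp only:) (intro sum.cong refl, simp add: path_weight_plus_boxes[OF sl])
  qed
  also have "\<dots> = (\<Sum>k\<in>level \<mu> (Suc n). \<Sum>l | l \<in> level \<mu> n \<and> k \<in> plus_boxes l. path_weight k \<mu> * real (num_syt l \<mu>) * G k)"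
    by (rule sum.swap_restrict[OF finite_level finite_level])
  also have "\<dots> = (\<Sum>k\<in>level \<mu> (Suc n). path_weight k \<mu> * real (num_syt k \<mu>) * G k)"
    by (intro sum.cong refl) (simp add: num_syt_Suc[OF \<mu>] sum_distrib_left sum_distrib_right)
  finally show ?case .
qed

section \<open>Binomial expansion and polynomiality\<close>

lemma Dop_sum: "Dop (\<lambda>l. \<Sum>r\<in>A. c r * F r l) l = (\<Sum>r\<in>A. c r * Dop (F r) l)"
proof -
  have "(\<Sum>k\<in>K. \<Sum>r\<in>A. c r * F r k) = (\<Sum>r\<in>A. c r * (\<Sum>k\<in>K. F r k))" for K
    by (subst sum.swap) (simp add: sum_distrib_left)
  then show ?thesis
    by (simp add: Dop_def distrib_left right_diff_distrib sum.distrib sum_subtractf sum_distrib_left mult.left_commute)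
qed

text \<open>Pascal's rule, in the shape needed for one more factor \<open>1 + D\<close>.\<close>

lemma sum_binomial_Suc:
  fixes a :: "nat \<Rightarrow> real"
  shows "(\<Sum>r\<le>Suc n. real (Suc n choose r) * a r) = (\<Sum>r\<le>n. real (n choose r) * (a (Suc r) + a r))"
proof -
  have "(\<Sum>r\<le>Suc n. real (n choose r) * a r) = a 0 + (\<Sum>r\<le>n. real (n choose Suc r) * a (Suc r))"
    by (subst sum.atMost_Suc_shift) simp
  then have *: "(\<Sum>r\<le>n. real (n choose r) * a r) = a 0 + (\<Sum>r\<le>n. real (n choose Suc r) * a (Suc r))"
    by (simp add: binomial_eq_0)
  have "(\<Sum>r\<le>Suc n. real (Suc n choose r) * a r) =
    a 0 + (\<Sum>r\<le>n. real (n choose r) * a (Suc r) + real (n choose Suc r) * a (Suc r))"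
    by (subst sum.atMost_Suc_shift) (simp add: distrib_right)
  then show ?thesis using * by (simp add: sum.distrib distrib_left)
qed

lemma Uop_funpow_binomial: "(Uop ^^ n) G l = (\<Sum>r\<le>n. real (n choose r) * (Dop ^^ r) G l)"
proof (induction n arbitrary: l)
  case (Suc n)
  then have "(Uop ^^ n) G = (\<lambda>l. \<Sum>r\<le>n. real (n choose r) * (Dop ^^ r) G l)" by (rule ext)
  then have "(Uop ^^ Suc n) G l = Uop (\<lambda>l. \<Sum>r\<le>n. real (n choose r) * (Dop ^^ r) G l) l" by simp
  also have "\<dots> = (\<Sum>r\<le>n. real (n choose r) * ((Dop ^^ Suc r) G l + (Dop ^^ r) G l))"
    by (simp add: Uop_def Dop_sum sum.distrib distrib_left)
  finally show ?case unfolding sum_binomial_Suc .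
qed simp

lemma Dop_funpow_eq_0_mono:
  assumes "\<And>l. strict_part l \<Longrightarrow> (Dop ^^ r) G l = 0" "r \<le> s" "strict_part l"
  shows "(Dop ^^ s) G l = 0"
  using assms(2,3)
proof (induction s arbitrary: l rule: dec_induct)
  case (step s)
  have "Dop ((Dop ^^ s) G) l = Dop (\<lambda>_. 0) l"
    using step by (intro Dop_cong) auto
  moreover have "Dop (\<lambda>_. 0) l = 0" by (simp add: Dop_def)
  ultimately show ?case by simp
qed (use assms(1) in auto)

text \<open>Binomial coefficients vanish for \<open>r > n\<close> and \<open>a r\<close> from
  \<open>R\<close> on, so the range can be replaced by the fixed \<open>r < R\<close>. Each
  \<open>n choose r\<close> is a falling factorial in \<open>n\<close> over
  \<open>fact r\<close>.\<close>

lemma binomial_sum_polynomial: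
  fixes a :: "nat \<Rightarrow> real"
  assumes "\<And>r. R \<le> r \<Longrightarrow> a r = 0"
  shows "\<exists>p. \<forall>n. (\<Sum>r\<le>n. real (n choose r) * a r) = poly p (real n)"
proof -
  let ?p = "\<Sum>r<R. smult (a r / fact r) (\<Prod>i = 0..<r. [:- real i, 1:])"
  have "(\<Sum>r\<le>n. real (n choose r) * a r) = poly ?p (real n)" for n
  proof -
    have "(\<Sum>r\<le>n. real (n choose r) * a r) = (\<Sum>r<max R (Suc n). real (n choose r) * a r)"
      by (intro sum.mono_neutral_left) (auto simp: binomial_eq_0)
    also have "\<dots> = (\<Sum>r<R. real (n choose r) * a r)"
      using assms by (intro sum.mono_neutral_right) auto
    also have "\<dots> = poly ?p (real n)"
      unfolding poly_sum
      by (intro sum.cong refl) (simp add: binomial_gbinomial gbinomial_prod_rev poly_prod)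
    finally show ?thesis .
  qed
  then show ?thesis by blast
qed

theorem theorem4p1:
  fixes nu mu :: "nat list" and Q :: "nat list \<Rightarrow> real"
  assumes "int_partition nu" and "strict_part mu" and "is_symfun Q"
  shows "(\<exists>r::nat. \<forall>l. strict_part l \<longrightarrow>
            (Dop ^^ r) (\<lambda>l. sym_eval Q (diagram l) content_binom * qnu nu l / real (H l)) l = 0)
    \<and> (\<exists>p :: real poly. \<forall>n::nat.
         (\<Sum>l\<in>{l. strict_part l \<and> contains l mu \<and> sum_list l = sum_list mu + n}.
            (2::real) powi (int (sum_list l) - int (sum_list mu) - int (length l) + int (length mu))
            * real (num_syt l mu) / real (H l)
            * sym_eval Q (diagram l) content_binom * qnu nu l)
         = poly p (real n))"
proof -
  let ?G = "\<lambda>l. sym_eval Q (diagram l) content_binom * qnu nu l / real (H l)"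
  obtain d where "filt d (\<lambda>l. sym_eval Q (diagram l) content_binom)"
    using filt_sym_eval[OF assms(3)] by blast
  moreover have "0 \<notin> set nu" using assms(1) by (auto simp: int_partition_def)
  ultimately have "filt (d + sum_list nu) (\<lambda>l. sym_eval Q (diagram l) content_binom * qnu nu l)"
    using filt_mult filt_qnu by blast
  then obtain r where r: "\<And>l. strict_part l \<Longrightarrow> (Dop ^^ r) ?G l = 0"
    using Dop_funpow_filt by blast
  have "(Dop ^^ s) ?G mu = 0" if "r \<le> s" for s
    using Dop_funpow_eq_0_mono[OF r that assms(2)] .
  then obtain p where p: "\<And>n. (\<Sum>s\<le>n. real (n choose s) * (Dop ^^ s) ?G mu) = poly p (real n)"
    using binomial_sum_polynomial[of r "\<lambda>s. (Dop ^^ s) ?G mu"] by blast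
  have "(\<Sum>l\<in>{l. strict_part l \<and> contains l mu \<and> sum_list l = sum_list mu + n}.
      (2::real) powi (int (sum_list l) - int (sum_list mu) - int (length l) + int (length mu))
        * real (num_syt l mu) / real (H l) * sym_eval Q (diagram l) content_binom * qnu nu l) =
    poly p (real n)" for n
    \<comment> \<open>Read backwards from the polynomial: its binomial expansion, the power of
      \<open>Uop\<close> at \<open>mu\<close>, the sum over shapes.\<close>
    unfolding p[symmetric] Uop_funpow_binomial[symmetric] Uop_funpow[OF assms(2)] level_def path_weight_def
    by (intro sum.cong refl) simp
  then show ?thesis using r by blast
qed

end
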